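(* Let $$W(z)= e^{Az+\frac{A_0}{z}}\, z^{B}\,\frac{\prod_{\nu>0} \left(1+\frac{z}{a_\nu}\right)^{\kappa_\nu}}{\prod_{\mu>0} \left(1-\frac{z}{b_\mu}\right)^{\lambda_\mu}}\cdot\frac{\prod_{\nu>0} \left(1+\frac{1}{zc_\nu}\right)^{\widetilde\kappa_\nu}}{\prod_{\mu>0} \left(1-\frac{1}{zd_\mu}\right)^{\widetilde\lambda_\mu}},$$ where $B\in\mathbb{R}$, $A,A_0\ge 0$, $a_\nu,b_\mu,c_\nu,d_\mu>0$, the exponents $\kappa_\nu,\widetilde\kappa_\nu,\lambda_\mu,\widetilde\lambda_\mu$ are positive integers, and $W(z)\not\equiv z^B$. The branch of $z^B$ is the one which is smooth in $\overline{\mathbb{C}_+}\setminus\{0\}$ and positive for $z>0$, and $W(\overline z)=\overline{W(z)}$ defines $W$ in the lower half-plane. Let $\alpha\in\mathbb{C}\setminus\mathbb{R}$ be such that $\alpha e^{iB\pi}\notin\mathbb{R}$ and $\alpha e^{-iB\pi}\notin\mathbb{R}$. Then each $\alpha$-point of $W$ in $\mathbb{C}\setminus\mathbb{R}$ is simple and distinct in absolute value from the other $\alpha$-points. If $z_i,z_{i+1}$ are two consecutive points of the $\alpha$-set (ordered by absolute value), then $\Im z_i\cdot\Im z_{i+1}<0$. Moreover, the equations $W(x)=\alpha$ and $W_\pm(-x):=\lim_{y\to\pm0}W(-x+iy)=\alpha$ have no solution $x>0$.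
   Context: $\mathbb{C}_+=\{z:\Im z>0\}$. An $\alpha$-point of $f$ is a $z_*$ with $f(z_* )=\alpha$, simple if $f'(z_* )\neq0$; the $\alpha$-set is the set of all $\alpha$-points. The products are finite, infinite or empty and absolutely convergent ($\sum\kappa_\nu/a_\nu$, $\sum\lambda_\mu/b_\mu$, $\sum\widetilde\kappa_\nu/c_\nu$, $\sum\widetilde\lambda_\mu/d_\mu<\infty$). The $\alpha$-points are numbered so that $\cdots\le|z_0|\le|z_1|\le|z_2|\le\cdots$. *)

theory Defs
  imports "HOL-Analysis.Analysis"
begin

text \<open>Product over an arbitrary (finite, infinite or empty) set of indices.\<close>

definition indexed_prod :: "nat set \<Rightarrow> (nat \<Rightarrow> complex) \<Rightarrow> complex" where
  "indexed_prod I f = prodinf (\<lambda>n. if n \<in> I then f n else 1)"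

text \<open>
  On the closed upper half-plane without the origin, the principal power
  \<open>z powr of_real B\<close> is the continuous branch with argument in \<open>[0, \<pi>]\<close>; in particular, on the
  negative axis it is the limit from above.
\<close>

definition W_upper ::
  "real \<Rightarrow> real \<Rightarrow> real
    \<Rightarrow> nat set \<Rightarrow> (nat \<Rightarrow> real) \<Rightarrow> (nat \<Rightarrow> nat)
    \<Rightarrow> nat set \<Rightarrow> (nat \<Rightarrow> real) \<Rightarrow> (nat \<Rightarrow> nat)
    \<Rightarrow> nat set \<Rightarrow> (nat \<Rightarrow> real) \<Rightarrow> (nat \<Rightarrow> nat)
    \<Rightarrow> nat set \<Rightarrow> (nat \<Rightarrow> real) \<Rightarrow> (nat \<Rightarrow> nat)
    \<Rightarrow> complex \<Rightarrow> complex" where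
  "W_upper A A0 B Na a k Nb b l Nc c kt Nd d lt z =
     exp (of_real A * z + of_real A0 / z) * z powr of_real B
     * (indexed_prod Na (\<lambda>n. (1 + z / of_real (a n)) ^ k n)
        / indexed_prod Nb (\<lambda>n. (1 - z / of_real (b n)) ^ l n))
     * (indexed_prod Nc (\<lambda>n. (1 + 1 / (z * of_real (c n))) ^ kt n)
        / indexed_prod Nd (\<lambda>n. (1 - 1 / (z * of_real (d n))) ^ lt n))"

text \<open>
  The value on the negative axis is the one from above. At the origin and at the poles, where
  \<open>W\<close> is not defined mathematically, division by zero and \<open>0 powr _ = 0\<close> give the value \<open>0\<close>, so
  these points are never \<open>\<alpha>\<close>-points for a nonreal \<open>\<alpha>\<close>.
\<close>

definition W_fun ::
  "real \<Rightarrow> real \<Rightarrow> real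
    \<Rightarrow> nat set \<Rightarrow> (nat \<Rightarrow> real) \<Rightarrow> (nat \<Rightarrow> nat)
    \<Rightarrow> nat set \<Rightarrow> (nat \<Rightarrow> real) \<Rightarrow> (nat \<Rightarrow> nat)
    \<Rightarrow> nat set \<Rightarrow> (nat \<Rightarrow> real) \<Rightarrow> (nat \<Rightarrow> nat)
    \<Rightarrow> nat set \<Rightarrow> (nat \<Rightarrow> real) \<Rightarrow> (nat \<Rightarrow> nat)
    \<Rightarrow> complex \<Rightarrow> complex" where
  "W_fun A A0 B Na a k Nb b l Nc c kt Nd d lt z =
     (if Im z \<ge> 0 then W_upper A A0 B Na a k Nb b l Nc c kt Nd d lt z
      else cnj (W_upper A A0 B Na a k Nb b l Nc c kt Nd d lt (cnj z)))"

definition alpha_set :: "(complex \<Rightarrow> complex) \<Rightarrow> complex \<Rightarrow> complex set" where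
  "alpha_set f \<alpha> = {z. f z = \<alpha>}"

definition simple_point :: "(complex \<Rightarrow> complex) \<Rightarrow> complex \<Rightarrow> bool" where
  "simple_point f z \<longleftrightarrow> deriv f z \<noteq> 0"

definition W_plus :: "(complex \<Rightarrow> complex) \<Rightarrow> real \<Rightarrow> complex" where
  "W_plus f x = Lim (at_right 0) (\<lambda>y. f (Complex x y))"

definition W_minus :: "(complex \<Rightarrow> complex) \<Rightarrow> real \<Rightarrow> complex" where
  "W_minus f x = Lim (at_left 0) (\<lambda>y. f (Complex x y))"

text \<open>
  Consecutive points of a set ordered by absolute value. This does not depend on choosing a
  numbering; the lemma below shows that neighbours in any numbering (finite, one-sided or
  two-sided infinite) by nondecreasing absolute value are consecutive in this sense.
\<close>

definition consecutive_in :: "complex set \<Rightarrow> complex \<Rightarrow> complex \<Rightarrow> bool" where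
  "consecutive_in S z w \<longleftrightarrow>
     z \<in> S \<and> w \<in> S \<and> z \<noteq> w \<and> cmod z \<le> cmod w \<and>
     \<not> (\<exists>u\<in>S. cmod z < cmod u \<and> cmod u < cmod w)"

lemma consecutive_in_numbering:
  fixes J :: "int set" and \<zeta> :: "int \<Rightarrow> complex"
  assumes bij: "bij_betw \<zeta> J S"
    and mono: "\<And>i j. i \<in> J \<Longrightarrow> j \<in> J \<Longrightarrow> i \<le> j \<Longrightarrow> cmod (\<zeta> i) \<le> cmod (\<zeta> j)"
    and i: "i \<in> J" "i + 1 \<in> J"
  shows "consecutive_in S (\<zeta> i) (\<zeta> (i + 1))"
proof -
  have ne: "\<zeta> i \<noteq> \<zeta> (i + 1)"
    using inj_onD[OF bij_betw_imp_inj_on[OF bij], of i "i + 1"] i by auto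
  have "\<not> (cmod (\<zeta> i) < cmod u \<and> cmod u < cmod (\<zeta> (i + 1)))" if u: "u \<in> S" for u
  proof -
    obtain j where j: "j \<in> J" "u = \<zeta> j"
      using u bij by (auto simp: bij_betw_def)
    have "j \<le> i \<or> i + 1 \<le> j"
      by linarith
    then show ?thesis
      using mono j i by (meson linorder_not_less)
  qed
  then show ?thesis
    using ne i mono bij by (auto simp: consecutive_in_def bij_betw_def)
qed

end

(*
In the variable \<zeta> = ln z the upper half-plane becomes the strip 0 < Im \<zeta> < pi, and W = exp F there
for a holomorphic F. Every factor of W contributes a nonnegative imaginary part to F', and some factor
a positive one. Hence W' never vanishes, and Im ((F \<zeta>' - F \<zeta>) / (\<zeta>' - \<zeta>)) > 0 throughout the strip.
Taking \<zeta>' - \<zeta> imaginary, |W| decreases strictly with the argument on half-circles about 0, which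
separates the absolute values of the \<alpha>-points.
Taking F \<zeta>' - F \<zeta> in 2 pi i Z, the argument of W grows by at least 2 pi between two \<alpha>-points of the upper
half-plane. Along the level curve |W| = |\<alpha>| joining them W therefore passes through cnj \<alpha>,
which gives an \<alpha>-point in the lower half-plane. On the boundary W is real, respectively
real up to the factor exp (\<plusminus> i B pi), so the conditions on \<alpha> keep this point off the real axis.
*)

theory Submission
  imports Defs "HOL-Complex_Analysis.Complex_Analysis"
begin

section \<open>Genus-zero products with negative zeros\<close>

text \<open>Expansion gives \<open>(1 + norm x) ^ k - 1\<close>, and
  \<open>exp t - 1 \<le> t * exp t\<close> is used at t = k |x|. Multiplicities thus enter only
  through k |x|, which becomes summable after division by the zeros.\<close>

lemma norm_power_one_plus_diff_le:
  fixes x :: complex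
  shows "norm ((1 + x) ^ k - 1) \<le> real k * norm x * exp (real k * norm x)"
proof -
  have "norm ((1 + x) ^ k - 1) \<le> (1 + norm x) ^ k - 1"
    using norm_prod_minus1_le_prod_minus1[of "\<lambda>_. x" "{..<k}"] by simp
  also have "(1 + norm x) ^ k \<le> exp (norm x) ^ k"
    by (intro power_mono exp_ge_add_one_self) auto
  also have "\<dots> = exp (real k * norm x)"
    by (simp add: exp_of_nat_mult)
  also have "exp t - 1 \<le> t * exp t" for t :: real
    using exp_ge_add_one_self[of "- t"] mult_right_mono[of "1 - t" "exp (- t)" "exp t"]
    by (simp add: exp_minus algebra_simps)
  finally show ?thesis
    by simp
qed

text \<open>One locale serves all four products of W: they are values of such functions at z, -z,
  1/z and -1/z.\<close>

locale negative_zero_product =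
  fixes I :: "nat set" and a :: "nat \<Rightarrow> real" and k :: "nat \<Rightarrow> nat"
  assumes a_pos: "\<And>n. n \<in> I \<Longrightarrow> a n > 0"
    and k_pos: "\<And>n. n \<in> I \<Longrightarrow> k n > 0"
    and summable_on: "(\<lambda>n. real (k n) / a n) summable_on I"
begin

definition factor :: "nat \<Rightarrow> complex \<Rightarrow> complex" where
  "factor n w = (if n \<in> I then (1 + w / of_real (a n)) ^ k n else 1)"

definition E :: "complex \<Rightarrow> complex" where
  "E w = indexed_prod I (\<lambda>n. (1 + w / of_real (a n)) ^ k n)"

lemma E_eq: "E w = prodinf (\<lambda>n. factor n w)"
  by (simp add: E_def indexed_prod_def factor_def)

text \<open>Extension by zero turns summability over the index set into an ordinary series, the
  Weierstrass majorant up to a constant.\<close>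

definition wt :: "nat \<Rightarrow> real" where
  "wt n = (if n \<in> I then real (k n) / a n else 0)"

lemma wt_nonneg: "wt n \<ge> 0"
  using a_pos[of n] by (auto simp: wt_def intro: divide_nonneg_pos)

lemma summable_wt: "summable wt"
proof -
  have "wt summable_on UNIV \<longleftrightarrow> (\<lambda>n. real (k n) / a n) summable_on I"
    by (rule summable_on_cong_neutral) (auto simp: wt_def)
  then show ?thesis
    using summable_on by (auto intro: summable_on_imp_summable)
qed

text \<open>In the exponent each weight is replaced by the sum of all weights, so the constant
  depends on the radius alone.\<close>

lemma factor_bound:
  assumes "norm w \<le> R"
  shows "norm (factor n w - 1) \<le> wt n * (R * exp (suminf wt * R))"
proof (cases "n \<in> I")
  case True
  have R: "R \<ge> 0"
    using assms norm_ge_zero[of w] by linarith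
  have le: "wt n \<le> suminf wt"
    using sum_le_suminf[OF summable_wt, of "{n}"] wt_nonneg by auto
  have eq: "real (k n) * norm (w / of_real (a n)) = wt n * norm w"
    using True a_pos[of n] by (simp add: wt_def norm_divide)
  have "norm (factor n w - 1) \<le> wt n * norm w * exp (wt n * norm w)"
    using norm_power_one_plus_diff_le[of "w / of_real (a n)" "k n"] True
    by (simp only: factor_def eq if_True)
  also have "\<dots> \<le> wt n * R * exp (suminf wt * R)"
    using assms R le wt_nonneg[of n]
    by (intro mult_mono) (simp_all add: mult_mono)
  finally show ?thesis
    by (simp add: mult_ac)
qed (use wt_nonneg[of n] in \<open>simp add: factor_def wt_def\<close>)

lemma convergent_factor: "convergent_prod (\<lambda>n. factor n w)"
proof (intro abs_convergent_prod_imp_convergent_prod summable_imp_abs_convergent_prod)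
  show "summable (\<lambda>n. norm (factor n w - 1))"
    by (rule summable_comparison_test[OF _ summable_mult2[OF summable_wt]])
      (use factor_bound[of w "norm w"] in auto)
qed

lemma LIMSEQ_E: "(\<lambda>n. \<Prod>m<n. factor m w) \<longlonglongrightarrow> E w"
  using convergent_prod_LIMSEQ[OF convergent_factor]
  by (simp add: E_eq LIMSEQ_lessThan_iff_atMost)

lemma factor_holomorphic: "factor n holomorphic_on A"
  unfolding factor_def by (cases "n \<in> I") (use a_pos[of n] in \<open>auto intro!: holomorphic_intros\<close>)

lemma uniform_limit_E:
  "uniform_limit (cball z 1) (\<lambda>n w. \<Prod>m<n. factor m w) E sequentially"
proof -
  have "uniformly_convergent_on (cball z 1) (\<lambda>n w. \<Prod>m<n. factor m w)"
  proof (rule uniformly_convergent_on_prod')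
    show "continuous_on (cball z 1) (factor n)" for n
      by (intro holomorphic_on_imp_continuous_on factor_holomorphic)
    have bd: "norm w \<le> norm z + 1" if "w \<in> cball z 1" for w
      using that norm_triangle_ineq2[of w z] by (auto simp: dist_norm norm_minus_commute)
    show "uniformly_convergent_on (cball z 1) (\<lambda>N w. \<Sum>n<N. norm (factor n w - 1))"
      by (rule Weierstrass_m_test'[OF _ summable_mult2[OF summable_wt]])
        (use factor_bound[OF bd] in auto)
  qed auto
  then obtain l where l: "uniform_limit (cball z 1) (\<lambda>n w. \<Prod>m<n. factor m w) l sequentially"
    by (auto simp: uniformly_convergent_on_def)
  \<comment> \<open>\<open>l\<close> is only known to exist; uniqueness of pointwise limits
    identifies it with \<open>E\<close>.\<close>
  have "l w = E w" if "w \<in> cball z 1" for w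
    using tendsto_uniform_limitI[OF l that] LIMSEQ_E LIMSEQ_unique by blast
  then show ?thesis
    using l uniform_limit_cong'[where f = "\<lambda>n w. \<Prod>m<n. factor m w"
        and g = "\<lambda>n w. \<Prod>m<n. factor m w" and h = l and i = E and X = "cball z 1"] by simp
qed

text \<open>Locally uniform limits of holomorphic functions may be differentiated term by term. The
  second claim lets logarithmic derivatives pass to the limit.\<close>

lemma E_derivative:
  "(E has_field_derivative deriv E z) (at z)"
  "(\<lambda>n. deriv (\<lambda>w. \<Prod>m<n. factor m w) z) \<longlonglongrightarrow> deriv E z"
proof -
  have hol: "(\<lambda>w. \<Prod>m<n. factor m w) holomorphic_on UNIV" for n
    by (intro holomorphic_intros factor_holomorphic)
  obtain g' where g': "\<And>w. w \<in> ball z 1 \<Longrightarrow> (E has_field_derivative g' w) (at w) \<and>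
      (\<lambda>n. deriv (\<lambda>w. \<Prod>m<n. factor m w) w) \<longlonglongrightarrow> g' w"
  proof (rule has_complex_derivative_uniform_limit[OF _ uniform_limit_E[of z]])
    show "\<forall>\<^sub>F n in sequentially. continuous_on (cball z 1) (\<lambda>w. \<Prod>m<n. factor m w) \<and>
      (\<forall>w\<in>ball z 1. ((\<lambda>w. \<Prod>m<n. factor m w) has_field_derivative
         deriv (\<lambda>w. \<Prod>m<n. factor m w) w) (at w))"
      by (intro always_eventually allI conjI ballI holomorphic_derivI[OF hol]
          holomorphic_on_imp_continuous_on[OF holomorphic_on_subset[OF hol subset_UNIV]]) auto
  qed auto
  have "g' z = deriv E z"
    using g'[of z] by (auto intro: DERIV_imp_deriv[symmetric])
  then show "(E has_field_derivative deriv E z) (at z)"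
    "(\<lambda>n. deriv (\<lambda>w. \<Prod>m<n. factor m w) z) \<longlonglongrightarrow> deriv E z"
    using g'[of z] by auto
qed

lemma E_holomorphic: "E holomorphic_on A"
  using E_derivative(1) has_field_derivative_at_within[of E _ _ A]
  by (auto simp: holomorphic_on_def field_differentiable_def)

lemma factor_eq_0D: "factor n w = 0 \<Longrightarrow> w \<in> \<real>\<^sub>\<le>\<^sub>0 \<and> w \<noteq> 0"
proof -
  assume "factor n w = 0"
  then have n: "n \<in> I" and "1 + w / of_real (a n) = 0"
    by (auto simp: factor_def split: if_splits)
  then have "w = of_real (- a n)"
    using a_pos[OF n] by (simp add: field_simps add_eq_0_iff)
  then show ?thesis
    using a_pos[OF n] by (auto simp del: of_real_minus)
qed

lemma E_nonzero: "w \<notin> \<real>\<^sub>\<le>\<^sub>0 \<Longrightarrow> E w \<noteq> 0"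
  using prodinf_nonzero[OF convergent_factor] factor_eq_0D by (metis E_eq)

lemma E_real: "w \<in> \<real> \<Longrightarrow> E w \<in> \<real>"
proof -
  assume "w \<in> \<real>"
  then have "(\<Prod>m<n. factor m w) \<in> \<real>" for n
    by (auto simp: factor_def intro!: prod_in_Reals)
  then show ?thesis
    using closed_sequentially[OF closed_complex_Reals _ LIMSEQ_E[of w]] by blast
qed

text \<open>The logarithmic derivative of the m-th factor.\<close>

definition pole_term :: "complex \<Rightarrow> nat \<Rightarrow> complex" where
  "pole_term z m = (if m \<in> I then of_nat (k m) / (of_real (a m) + z) else 0)"

lemma partial_product_deriv:
  assumes "Im z \<noteq> 0"
  shows "((\<lambda>w. \<Prod>m<n. factor m w) has_field_derivative
          (\<Prod>m<n. factor m z) * (\<Sum>m<n. pole_term z m)) (at z)"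
proof (induction n)
  case (Suc n)
  have f: "(factor n has_field_derivative factor n z * pole_term z n) (at z)"
  proof (cases "n \<in> I")
    case True
    then have a: "a n > 0" and k: "k n > 0"
      using a_pos k_pos by auto
    have nz: "of_real (a n) + z \<noteq> 0"
      using assms by (auto simp: complex_eq_iff)
    obtain j where j: "k n = Suc j"
      using k gr0_implies_Suc by blast
    have "((\<lambda>w. (1 + w / of_real (a n)) ^ k n) has_field_derivative
        of_nat (k n) * (1 + z / of_real (a n)) ^ j * (1 / of_real (a n))) (at z)"
    proof -
      have "((\<lambda>w. 1 + w / of_real (a n)) has_field_derivative 1 / of_real (a n)) (at z)"
        by (rule DERIV_cong[OF DERIV_add[OF DERIV_const DERIV_cdivide[OF DERIV_ident]]]) simp
      then show ?thesis
        unfolding j by (rule DERIV_cong[OF DERIV_power_Suc]) simp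
    qed
    moreover have "of_nat (k n) * (1 + z / of_real (a n)) ^ j * (1 / of_real (a n))
        = (1 + z / of_real (a n)) ^ k n * (of_nat (k n) / (of_real (a n) + z))"
    proof -
      have "1 + z / of_real (a n) = (of_real (a n) + z) / of_real (a n)"
        using a by (simp add: field_simps)
      then show ?thesis
        using nz by (simp add: j)
    qed
    ultimately show ?thesis
      using True unfolding factor_def pole_term_def by simp
  next
    case False
    then have "factor n = (\<lambda>_. 1)"
      by (simp add: factor_def fun_eq_iff)
    then show ?thesis
      using False by (simp add: pole_term_def)
  qed
  show ?case
    using DERIV_mult[OF Suc.IH f] by (simp add: algebra_simps)
qed simp

text \<open>Multiplying numerator and denominator of z/(a + z) by the conjugate of a + z gives the
  imaginary part a Im z / |a + z|^2. The extra factor Im z makes the result nonnegative in both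
  half-planes at once.\<close>

lemma Im_pole_term: "Im z * Im (z * pole_term z m) =
   (if m \<in> I then real (k m) * a m * (Im z)\<^sup>2 / (cmod (of_real (a m) + z))\<^sup>2 else 0)"
proof (cases "m \<in> I")
  case True
  have "z * pole_term z m = of_nat (k m) * (z * cnj (of_real (a m) + z)) /
      of_real ((cmod (of_real (a m) + z))\<^sup>2)"
    using True complex_div_cnj[of "z * of_nat (k m)" "of_real (a m) + z"]
    by (simp add: pole_term_def mult_ac)
  moreover have "Im (z * cnj (of_real (a m) + z)) = a m * Im z"
    by (simp add: algebra_simps)
  ultimately show ?thesis
    using True by (simp add: Im_divide_of_real power2_eq_square del: of_real_power)
qed (simp add: pole_term_def)

text \<open>\<open>E\<close> and its partial products are nonzero off the real axis, so the
  logarithmic derivatives of the partial products, which are sums of pole terms, converge to that of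
  \<open>E\<close>.\<close>

lemma E_logderiv_lim:
  assumes "Im z \<noteq> 0"
  shows "(\<lambda>n. \<Sum>m<n. Im z * Im (z * pole_term z m)) \<longlonglongrightarrow> Im z * Im (z * deriv E z / E z)"
proof -
  have nR: "z \<notin> \<real>\<^sub>\<le>\<^sub>0"
    using assms by (auto simp: complex_nonpos_Reals_iff)
  have nz: "(\<Prod>m<n. factor m z) \<noteq> 0" for n
    using factor_eq_0D nR by auto
  have "(\<lambda>n. Im z * Im (z * deriv (\<lambda>w. \<Prod>m<n. factor m w) z / (\<Prod>m<n. factor m z)))
      \<longlonglongrightarrow> Im z * Im (z * deriv E z / E z)"
    by (intro tendsto_intros E_derivative(2) LIMSEQ_E E_nonzero nR)
  moreover have "Im z * Im (z * deriv (\<lambda>w. \<Prod>m<n. factor m w) z / (\<Prod>m<n. factor m z))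
    = (\<Sum>m<n. Im z * Im (z * pole_term z m))" for n
  proof -
    have "z * deriv (\<lambda>w. \<Prod>m<n. factor m w) z / (\<Prod>m<n. factor m z)
       = (\<Sum>m<n. z * pole_term z m)"
      using DERIV_imp_deriv[OF partial_product_deriv[OF assms, of n]] nz[of n]
      by (simp add: sum_distrib_left[symmetric])
    then show ?thesis
      by (simp only: sum_distrib_left Im_sum)
  qed
  ultimately show ?thesis
    by simp
qed

lemma E_logderiv_nonneg:
  assumes "Im z \<noteq> 0"
  shows "Im z * Im (z * deriv E z / E z) \<ge> 0"
proof (rule LIMSEQ_le_const[OF E_logderiv_lim[OF assms]])
  show "\<exists>N. \<forall>n\<ge>N. 0 \<le> (\<Sum>m<n. Im z * Im (z * pole_term z m))"
    using a_pos by (intro exI allI impI sum_nonneg) (simp add: Im_pole_term less_imp_le del: times_complex.sel)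
qed

text \<open>Strictness could be lost in the limit, but one positive term with index j bounds all
  partial sums that contain it from below.\<close>

lemma E_logderiv_pos:
  assumes "Im z \<noteq> 0" "I \<noteq> {}"
  shows "Im z * Im (z * deriv E z / E z) > 0"
proof -
  obtain j where j: "j \<in> I"
    using assms by auto
  have nn: "Im z * Im (z * pole_term z m) \<ge> 0" for m
    using a_pos by (simp add: Im_pole_term less_imp_le del: times_complex.sel)
  have "of_real (a j) + z \<noteq> 0"
    using assms by (auto simp: complex_eq_iff)
  then have "0 < Im z * Im (z * pole_term z j)"
    using j a_pos k_pos assms by (simp add: Im_pole_term del: times_complex.sel)
  also have "\<dots> \<le> Im z * Im (z * deriv E z / E z)"
  proof (rule LIMSEQ_le_const[OF E_logderiv_lim[OF assms(1)]])
    show "\<exists>N. \<forall>n\<ge>N. Im z * Im (z * pole_term z j) \<le> (\<Sum>m<n. Im z * Im (z * pole_term z m))"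
      by (intro exI[of _ "Suc j"] allI impI member_le_sum nn) auto
  qed
  finally show ?thesis .
qed

end

section \<open>Difference quotients and level curves\<close>

text \<open>Along the segment from z to w, parametrized by t, the function F / (w - z) has
  derivative F', so its imaginary part increases from one end to the other.\<close>

lemma Im_difference_quotient_pos:
  fixes F F' :: "complex \<Rightarrow> complex"
  assumes S: "convex S" and z: "z \<in> S" and w: "w \<in> S" and "z \<noteq> w"
    and deriv: "\<And>x. x \<in> S \<Longrightarrow> (F has_field_derivative F' x) (at x)"
    and pos: "\<And>x. x \<in> S \<Longrightarrow> Im (F' x) > 0"
  shows "Im ((F w - F z) / (w - z)) > 0"
proof -
  define g where "g t = Im (F (z + of_real t * (w - z)) / (w - z))" for t
  have "g 0 < g 1"
  proof (rule DERIV_pos_imp_increasing[where f = g and a = 0 and b = 1])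
    fix t :: real assume t: "0 \<le> t" "t \<le> 1"
    define x where "x = z + of_real t * (w - z)"
    have "x = (1 - t) *\<^sub>R z + t *\<^sub>R w"
      by (simp add: x_def scaleR_conv_of_real algebra_simps)
    then have x: "x \<in> S"
      using convexD[OF S z w, of "1 - t" t] t by simp
    have 1: "((\<lambda>t. z + of_real t * (w - z)) has_vector_derivative w - z) (at t)"
      by (auto intro!: derivative_eq_intros)
    have "((\<lambda>t. F (z + of_real t * (w - z))) has_vector_derivative (w - z) * F' x) (at t)"
      using field_vector_diff_chain_at[OF 1, of F "F' x"] deriv[OF x] by (simp add: x_def o_def)
    then have "((\<lambda>t. F (z + of_real t * (w - z)) / (w - z)) has_vector_derivative F' x) (at t)"
      using has_vector_derivative_divide[of _ "(w - z) * F' x" "at t" "w - z"] \<open>z \<noteq> w\<close> by auto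
    then have "(g has_real_derivative Im (F' x)) (at t)"
      unfolding g_def has_real_derivative_iff_has_vector_derivative
      by (rule bounded_linear.has_vector_derivative[OF bounded_linear_Im])
    then show "\<exists>y. (g has_real_derivative y) (at t) \<and> y > 0"
      using pos[OF x] by blast
  qed simp
  then show ?thesis
    by (simp add: g_def diff_divide_distrib)
qed

text \<open>For each s the strictly decreasing function \<open>h s\<close> has at most one zero. T
  picks it, or u or v if \<open>h s\<close> is negative or positive throughout. A closed graph over
  a compact range makes T continuous.\<close>

lemma clamped_level_curve:
  fixes h :: "real \<Rightarrow> real \<Rightarrow> real"
  assumes cont: "continuous_on ({s1..s2} \<times> {u..v}) (\<lambda>(s, t). h s t)" and uv: "u \<le> v"
    and decr: "\<And>s t t'. s1 \<le> s \<Longrightarrow> s \<le> s2 \<Longrightarrow> u \<le> t \<Longrightarrow> t < t' \<Longrightarrow> t' \<le> v \<Longrightarrow> h s t' < h s t"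
  obtains T where "continuous_on {s1..s2} T" "T \<in> {s1..s2} \<rightarrow> {u..v}"
    "\<And>s. s \<in> {s1..s2} \<Longrightarrow> T s = v \<or> h s (T s) \<le> 0"
    "\<And>s. s \<in> {s1..s2} \<Longrightarrow> T s = u \<or> h s (T s) \<ge> 0"
    "\<And>s t. s \<in> {s1..s2} \<Longrightarrow> t \<in> {u..v} \<Longrightarrow> h s t = 0 \<Longrightarrow> T s = t"
proof -
  \<comment> \<open>Each sign condition is waived at one endpoint: u qualifies when
    \<open>h s\<close> is nonpositive throughout, v when it is nonnegative throughout, so a solution
    always exists.\<close>
  define P where "P s t \<longleftrightarrow> t \<in> {u..v} \<and> (t = v \<or> h s t \<le> 0) \<and> (t = u \<or> h s t \<ge> 0)" for s t
  have ex: "\<exists>t. P s t" if s: "s \<in> {s1..s2}" for s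
  proof -
    have c: "continuous_on {u..v} (h s)"
    proof -
      have "continuous_on {u..v} (\<lambda>t. case (s, t) of (s, t) \<Rightarrow> h s t)"
        by (rule continuous_on_compose2[OF cont]) (use s in \<open>auto intro!: continuous_intros\<close>)
      then show ?thesis
        by simp
    qed
    consider "h s u \<le> 0" | "h s v \<ge> 0" | "h s v \<le> 0" "0 \<le> h s u"
      by linarith
    then show ?thesis
    proof cases
      case 3
      then obtain t where "t \<in> {u..v}" "h s t = 0"
        using IVT2'[OF 3 uv c] by auto
      then show ?thesis by (auto simp: P_def)
    qed (use uv in \<open>auto simp: P_def\<close>)
  qed
  \<comment> \<open>Two solutions t < t' would satisfy \<open>h s t \<le> 0\<close> and
    \<open>0 \<le> h s t'\<close>, against strict decrease.\<close>
  have uniq: "t = t'" if "s \<in> {s1..s2}" "P s t" "P s t'" for s t t'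
  proof -
    have False if s: "s \<in> {s1..s2}" and P: "P s t" "P s t'" and "t < t'" for t t'
      using decr[of s t t'] that by (auto simp: P_def)
    then show ?thesis
      using that by (meson linorder_less_linear)
  qed
  define T where "T s = (SOME t. P s t)" for s
  have T: "P s (T s)" if "s \<in> {s1..s2}" for s
    using someI_ex[OF ex[OF that]] by (simp add: T_def)
  have TP: "P s t \<longleftrightarrow> t = T s" if "s \<in> {s1..s2}" for s t
    using uniq[OF that] T[OF that] by blast
  have "continuous_on {s1..s2} T"
  proof (rule continuous_from_closed_graph)
    show "T \<in> {s1..s2} \<rightarrow> {u..v}"
      using T by (auto simp: P_def)
    let ?K = "{s1..s2} \<times> {u..v}"
    let ?h = "\<lambda>p. h (fst p) (snd p)"
    have ch: "continuous_on ?K ?h"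
      using cont by (simp add: case_prod_unfold)
    have K: "closed ?K"
      by (intro closed_Times) auto
    have "(\<lambda>s. (s, T s)) ` {s1..s2} = {p \<in> ?K. P (fst p) (snd p)}"
    proof (intro set_eqI iffI)
      fix p assume "p \<in> (\<lambda>s. (s, T s)) ` {s1..s2}"
      then obtain s where "s \<in> {s1..s2}" "p = (s, T s)"
        by blast
      then show "p \<in> {p \<in> ?K. P (fst p) (snd p)}"
        using T[of s] by (simp add: P_def)
    next
      fix p assume p: "p \<in> {p \<in> ?K. P (fst p) (snd p)}"
      then have "fst p \<in> {s1..s2}" "snd p = T (fst p)"
        using TP[of "fst p" "snd p"] by auto
      then show "p \<in> (\<lambda>s. (s, T s)) ` {s1..s2}"
        by (intro image_eqI[of _ _ "fst p"]) (auto simp: prod_eq_iff)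
    qed
    \<comment> \<open>\<open>P\<close> consists of equations and non-strict inequalities between
      continuous functions, so the graph is closed.\<close>
    also have "\<dots> = ({p \<in> ?K. snd p = v} \<union> {p \<in> ?K. ?h p \<le> 0}) \<inter> ({p \<in> ?K. snd p = u} \<union> {p \<in> ?K. 0 \<le> ?h p})"
      by (auto simp: P_def)
    also have "closed \<dots>"
      by (intro closed_Int closed_Un continuous_closed_preimage_constant[OF _ K]
          continuous_on_closed_Collect_le[OF _ _ K] ch continuous_intros)
    finally show "closed ((\<lambda>s. (s, T s)) ` {s1..s2})" .
  qed auto
  moreover have "T s = t" if "s \<in> {s1..s2}" "t \<in> {u..v}" "h s t = 0" for s t
    using TP[OF that(1), of t] that by (auto simp: P_def)
  ultimately show ?thesis
    using that[of T] T by (auto simp: P_def)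
qed

section \<open>Quotients on the strip: monotonicity and conjugate values\<close>

definition open_strip :: "complex set" where
  "open_strip = {\<zeta>. 0 < Im \<zeta> \<and> Im \<zeta> < pi}"

lemma convex_open_strip: "convex open_strip"
proof -
  have "open_strip = {\<zeta>. Im \<zeta> > 0} \<inter> {\<zeta>. Im \<zeta> < pi}"
    by (auto simp: open_strip_def)
  then show ?thesis
    using convex_Int[OF convex_halfspace_Im_gt[of 0] convex_halfspace_Im_lt[of pi]] by simp
qed

lemma open_open_strip: "open open_strip"
proof -
  have "open_strip = {\<zeta>. Im \<zeta> > 0} \<inter> {\<zeta>. Im \<zeta> < pi}"
    by (auto simp: open_strip_def)
  then show ?thesis
    using open_Int[OF open_halfspace_Im_gt[of 0] open_halfspace_Im_lt[of pi]] by simp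
qed

text \<open>
  The quotient \<open>N / D\<close> is kept as a pair, since on the boundary \<open>D\<close> may vanish on the line
  \<open>Im \<zeta> = 0\<close> and \<open>N\<close> on the line \<open>Im \<zeta> = pi\<close>.
\<close>

locale strip_quotient =
  fixes N D F F' :: "complex \<Rightarrow> complex" and \<beta> :: real
  assumes cont_N: "continuous_on {\<zeta>. 0 \<le> Im \<zeta> \<and> Im \<zeta> \<le> pi} N"
    and cont_D: "continuous_on {\<zeta>. 0 \<le> Im \<zeta> \<and> Im \<zeta> \<le> pi} D"
    and D_nonzero: "\<And>\<zeta>. \<zeta> \<in> open_strip \<Longrightarrow> D \<zeta> \<noteq> 0"
    and N_eq: "\<And>\<zeta>. \<zeta> \<in> open_strip \<Longrightarrow> N \<zeta> = D \<zeta> * exp (F \<zeta>)"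
    and F_deriv: "\<And>\<zeta>. \<zeta> \<in> open_strip \<Longrightarrow> (F has_field_derivative F' \<zeta>) (at \<zeta>)"
    and Im_F'_pos: "\<And>\<zeta>. \<zeta> \<in> open_strip \<Longrightarrow> Im (F' \<zeta>) > 0"
    and lower_nonzero: "\<And>\<zeta>. Im \<zeta> = 0 \<Longrightarrow> N \<zeta> \<noteq> 0"
    and lower_real: "\<And>\<zeta>. Im \<zeta> = 0 \<Longrightarrow> N \<zeta> * cnj (D \<zeta>) \<in> \<real>"
    and upper_nonzero: "\<And>\<zeta>. Im \<zeta> = pi \<Longrightarrow> D \<zeta> \<noteq> 0"
    and upper_real: "\<And>\<zeta>. Im \<zeta> = pi \<Longrightarrow> N \<zeta> * cnj (D \<zeta>) * exp (- \<i> * of_real \<beta>) \<in> \<real>"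
begin

lemma Im_F_quotient:
  "z \<in> open_strip \<Longrightarrow> w \<in> open_strip \<Longrightarrow> z \<noteq> w \<Longrightarrow> Im ((F w - F z) / (w - z)) > 0"
  using Im_difference_quotient_pos[OF convex_open_strip _ _ _ F_deriv Im_F'_pos] by blast

text \<open>On a vertical segment w - z is imaginary, so the imaginary part of the difference
  quotient is minus the increment of Re F over t' - t.\<close>

lemma Re_F_decreasing:
  assumes "0 < t" "t < t'" "t' < pi"
  shows "Re (F (Complex s t')) < Re (F (Complex s t))"
proof -
  have "Im ((F (Complex s t') - F (Complex s t)) / (Complex s t' - Complex s t)) > 0"
    by (rule Im_F_quotient) (use assms in \<open>auto simp: open_strip_def\<close>)
  also have "Complex s t' - Complex s t = \<i> * of_real (t' - t)"
    by (simp add: complex_eq_iff)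
  finally show ?thesis
    using assms by (simp add: Im_divide zero_less_divide_iff divide_less_0_iff mult_less_0_iff power2_eq_square)
qed

lemma Re_eq_imp_eq:
  assumes "z \<in> open_strip" "w \<in> open_strip" "Re z = Re w" "Re (F z) = Re (F w)"
  shows "z = w"
proof -
  obtain s t t' where [simp]: "z = Complex s t" "w = Complex s t'"
    using assms(3) by (metis complex.exhaust_sel)
  show ?thesis
    using assms Re_F_decreasing[of t t' s] Re_F_decreasing[of t' t s]
    by (cases t t' rule: linorder_cases) (auto simp: open_strip_def)
qed

text \<open>Equal exponentials mean F w - F z = 2 pi i n with an integer n. The difference quotient
  has imaginary part 2 pi n (Re w - Re z) / |w - z|^2, whose positivity forces n \<ge> 1.\<close>

lemma Im_F_increases_by_period:
  assumes zw: "z \<in> open_strip" "w \<in> open_strip" and "Re z < Re w" and eq: "exp (F z) = exp (F w)"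
  shows "Im (F w) \<ge> Im (F z) + 2 * pi"
proof -
  obtain n :: int where n: "F w = F z + of_int (2 * n) * of_real pi * \<i>"
    using eq[symmetric] unfolding exp_eq by auto
  have "Im ((F w - F z) / (w - z)) > 0"
    by (rule Im_F_quotient) (use assms in auto)
  then have "of_int n * (pi * (Re w - Re z)) > 0"
    using n \<open>Re z < Re w\<close>
    by (auto simp: Im_divide zero_less_divide_iff not_sum_power2_lt_zero zero_less_mult_iff)
  then have "n > 0"
    using zero_less_mult_pos2[of "real_of_int n" "pi * (Re w - Re z)"] \<open>Re z < Re w\<close> by simp
  then have "pi * 1 \<le> pi * of_int n"
    by (intro mult_left_mono) auto
  then show ?thesis
    using n by (simp add: mult.commute)
qed


text \<open>
  The level curve of height \<open>\<bar>\<alpha>\<bar>\<close>, clamped to the slightly smaller strip \<open>e \<le> Im \<zeta> \<le> pi - e\<close>, is a graph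
  over the real part along which \<open>Im F\<close> is continuous and grows by at least \<open>2 * pi\<close>. Clamping
  avoids extending \<open>F\<close> to the boundary, which the level curve may reach.
\<close>

lemma truncated_level_point:
  assumes zw: "z \<in> open_strip" "w \<in> open_strip" "Re z < Re w"
    and eq: "N z = \<alpha> * D z" "N w = \<alpha> * D w"
    and e: "0 < e" "e \<le> Im z" "Im z \<le> pi - e" "e \<le> Im w" "Im w \<le> pi - e"
  shows "\<exists>p. Re z \<le> Re p \<and> Re p \<le> Re w \<and> e \<le> Im p \<and> Im p \<le> pi - e \<and>
    (Im p = pi - e \<or> cmod (N p) \<le> cmod \<alpha> * cmod (D p)) \<and>
    (Im p = e \<or> cmod \<alpha> * cmod (D p) \<le> cmod (N p)) \<and>
    N p * cnj (D p) * \<alpha> \<in> \<real>\<^sub>\<ge>\<^sub>0"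
proof -
  define \<theta> where "\<theta> = Im (F z)"
  have Fz: "exp (F z) = \<alpha>" and Fw: "exp (F w) = \<alpha>"
    using N_eq D_nonzero zw eq by (metis mult.commute mult_cancel_right)+
  have norm_\<alpha>: "cmod \<alpha> = exp (Re (F z))" "cmod \<alpha> = exp (Re (F w))"
    using norm_exp_eq_Re[of "F z"] norm_exp_eq_Re[of "F w"] Fz Fw by simp_all
  have strip: "Complex s t \<in> open_strip" if "t \<in> {e..pi - e}" for s t
    using that e by (auto simp: open_strip_def)
  have cont_F: "continuous_on open_strip F"
    by (rule DERIV_continuous_on[OF has_field_derivative_at_within[OF F_deriv]])
  \<comment> \<open>The zeros of \<open>h\<close> are the points where \<open>exp F\<close> has
    absolute value |\<alpha>|.\<close>
  define h where "h s t = Re (F (Complex s t)) - Re (F z)" for s t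
  have "continuous_on ({Re z..Re w} \<times> {e..pi - e}) (\<lambda>(s, t). h s t)"
    unfolding h_def case_prod_unfold Complex_eq
    by (intro continuous_intros continuous_on_compose2[OF cont_F])
      (use strip in \<open>auto simp: Complex_eq\<close>)
  moreover have "h s t' < h s t" if "e \<le> t" "t < t'" "t' \<le> pi - e" for s t t'
    using Re_F_decreasing[of t t' s] that e by (simp add: h_def)
  moreover have "e \<le> pi - e"
    using e by linarith
  ultimately obtain T where T: "continuous_on {Re z..Re w} T" "T \<in> {Re z..Re w} \<rightarrow> {e..pi - e}"
    "\<And>s. s \<in> {Re z..Re w} \<Longrightarrow> T s = pi - e \<or> h s (T s) \<le> 0"
    "\<And>s. s \<in> {Re z..Re w} \<Longrightarrow> T s = e \<or> h s (T s) \<ge> 0"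
    "\<And>s t. s \<in> {Re z..Re w} \<Longrightarrow> t \<in> {e..pi - e} \<Longrightarrow> h s t = 0 \<Longrightarrow> T s = t"
    using clamped_level_curve[of "Re z" "Re w" e "pi - e" h] by blast
  \<comment> \<open>Both points lie on the level curve and in the clamped strip, so by uniqueness
    the curve runs from z to w.\<close>
  have ends: "T (Re z) = Im z" "T (Re w) = Im w"
    using T(5)[of "Re z" "Im z"] T(5)[of "Re w" "Im w"] zw e norm_\<alpha> by (auto simp: h_def)
  define V where "V s = Im (F (Complex s (T s)))" for s
  have contV: "continuous_on {Re z..Re w} V"
    unfolding V_def Complex_eq
    by (intro continuous_intros continuous_on_compose2[OF cont_F] T(1))
      (use strip T(2) in \<open>auto simp: Complex_eq Pi_iff\<close>)
  \<comment> \<open>\<open>c\<close> is the first value above \<open>\<theta>\<close> congruent to \<open>- \<theta>\<close> modulo \<open>2 * pi\<close>.\<close>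
  define u where "u = exp (- (2 * \<i> * of_real \<theta>))"
  define c where "c = \<theta> + Arg2pi u"
  have "exp (\<i> * of_real (Arg2pi u)) = u"
    using Arg2pi_eq[of u] by (simp add: u_def)
  then have exp_c: "exp (\<i> * of_real c) * exp (\<i> * of_real \<theta>) = 1"
    by (simp add: c_def u_def exp_add[symmetric] ring_distribs mult_exp_exp)
      (simp add: exp_add exp_minus u_def field_simps flip: exp_double)
  \<comment> \<open>\<open>V\<close> starts at \<theta> and ends at or above \<theta> + 2 pi, while
    \<open>Arg2pi\<close> lies in [0, 2 pi); so c is attained.\<close>
  have "V (Re z) \<le> c"
    using Arg2pi_ge_0[of u] by (simp add: V_def ends c_def \<theta>_def)
  moreover have "c \<le> V (Re w)"
    using Arg2pi_lt_2pi[of u] Im_F_increases_by_period[OF zw] Fz Fw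
    by (simp add: V_def ends c_def \<theta>_def)
  ultimately obtain s where s: "s \<in> {Re z..Re w}" "V s = c"
    using IVT'[of V "Re z" c "Re w"] contV zw by auto
  define p where "p = Complex s (T s)"
  have p: "p \<in> open_strip"
    using strip T(2) s by (auto simp: p_def Pi_iff)
  have Np: "N p = D p * exp (F p)" by (rule N_eq[OF p])
  have norm_Np: "cmod (N p) = exp (Re (F p)) * cmod (D p)"
    by (simp add: Np norm_mult)
  have expF: "exp x = of_real (exp (Re x)) * exp (\<i> * of_real (Im x))" for x :: complex
    by (metis complex_eq exp_add exp_of_real)
  have expFp: "exp (F p) = of_real (exp (Re (F p))) * exp (\<i> * of_real c)"
    using expF[of "F p"] s(2) by (simp add: V_def p_def)
  have expFz: "\<alpha> = of_real (exp (Re (F z))) * exp (\<i> * of_real \<theta>)"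
    using expF[of "F z"] by (simp add: Fz \<theta>_def)
  \<comment> \<open>The phases c and \<theta> cancel. Multiplication by \<open>cnj (D p)\<close>
    replaces division by \<open>D p\<close>, so the condition passes to boundary points where D
    vanishes.\<close>
  have "N p * cnj (D p) * \<alpha> = D p * cnj (D p) * of_real (exp (Re (F p)) * exp (Re (F z)))
      * (exp (\<i> * of_real c) * exp (\<i> * of_real \<theta>))"
    unfolding Np expFp expFz by (simp only: of_real_mult mult_ac)
  also have "\<dots> = of_real ((cmod (D p))\<^sup>2 * (exp (Re (F p)) * exp (Re (F z))))"
    by (simp only: exp_c mult_1_right of_real_mult complex_norm_square[symmetric])
  also have "\<dots> \<in> \<real>\<^sub>\<ge>\<^sub>0"
    by (simp only: nonneg_Reals_of_real_iff) simp
  finally have "N p * cnj (D p) * \<alpha> \<in> \<real>\<^sub>\<ge>\<^sub>0" .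
  moreover have "Im p = pi - e \<or> cmod (N p) \<le> cmod \<alpha> * cmod (D p)"
    using T(3)[OF s(1)] unfolding norm_Np norm_\<alpha>(1) h_def
    by (auto simp: p_def intro!: mult_right_mono)
  moreover have "Im p = e \<or> cmod \<alpha> * cmod (D p) \<le> cmod (N p)"
    using T(4)[OF s(1)] unfolding norm_Np norm_\<alpha>(1) h_def
    by (auto simp: p_def intro!: mult_right_mono)
  ultimately show ?thesis
    using s(1) T(2) by (intro exI[of _ p]) (auto simp: p_def Pi_iff)
qed

text \<open>The truncation e tends to 0. The truncated level points lie in a compact rectangle, and
  their conditions survive the limit since they involve only N and D, which are continuous up to the
  boundary.\<close>

lemma limiting_level_point:
  assumes zw: "z \<in> open_strip" "w \<in> open_strip" "Re z < Re w"
    and eq: "N z = \<alpha> * D z" "N w = \<alpha> * D w"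
  obtains p where "Re z \<le> Re p" "Re p \<le> Re w" "0 \<le> Im p" "Im p \<le> pi"
    "Im p = pi \<or> cmod (N p) \<le> cmod \<alpha> * cmod (D p)"
    "Im p = 0 \<or> cmod \<alpha> * cmod (D p) \<le> cmod (N p)"
    "N p * cnj (D p) * \<alpha> \<in> \<real>\<^sub>\<ge>\<^sub>0"
proof -
  \<comment> \<open>The smallest distance of z and w from the edges;
    \<open>e n \<le> \<delta>\<close> keeps both points in every truncated strip.\<close>
  define \<delta> where "\<delta> = min (min (Im z) (pi - Im z)) (min (Im w) (pi - Im w))"
  define e where "e n = \<delta> / real (Suc n)" for n
  have "\<delta> > 0"
    using zw by (auto simp: \<delta>_def open_strip_def)
  then have e: "0 < e n" "e n \<le> \<delta>" for n
    by (auto simp: e_def field_simps)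
  have e_lim: "e \<longlonglongrightarrow> 0"
    unfolding e_def by (rule LIMSEQ_Suc[OF lim_const_over_n])
  have bounds: "e n \<le> Im z" "Im z \<le> pi - e n" "e n \<le> Im w" "Im w \<le> pi - e n" for n
    using e(2)[of n] by (auto simp: \<delta>_def)
  define Q where "Q n p \<longleftrightarrow> Re z \<le> Re p \<and> Re p \<le> Re w \<and> e n \<le> Im p \<and> Im p \<le> pi - e n \<and>
    (Im p = pi - e n \<or> cmod (N p) \<le> cmod \<alpha> * cmod (D p)) \<and>
    (Im p = e n \<or> cmod \<alpha> * cmod (D p) \<le> cmod (N p)) \<and>
    N p * cnj (D p) * \<alpha> \<in> \<real>\<^sub>\<ge>\<^sub>0" for n p
  have "\<forall>n. \<exists>p. Q n p"
    unfolding Q_def using truncated_level_point[OF zw eq e(1) bounds] by blast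
  then obtain p where "\<forall>n. Q n (p n)"
    using choice by blast
  then have p: "Re z \<le> Re (p n)" "Re (p n) \<le> Re w" "e n \<le> Im (p n)" "Im (p n) \<le> pi - e n"
    "Im (p n) = pi - e n \<or> cmod (N (p n)) \<le> cmod \<alpha> * cmod (D (p n))"
    "Im (p n) = e n \<or> cmod \<alpha> * cmod (D (p n)) \<le> cmod (N (p n))"
    "N (p n) * cnj (D (p n)) * \<alpha> \<in> \<real>\<^sub>\<ge>\<^sub>0" for n
    by (auto simp: Q_def)
  define K where "K = cbox (Complex (Re z) 0) (Complex (Re w) pi)"
  have K_iff: "x \<in> K \<longleftrightarrow> Re z \<le> Re x \<and> Re x \<le> Re w \<and> 0 \<le> Im x \<and> Im x \<le> pi" for x
    by (auto simp: K_def in_cbox_complex_iff)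
  have "\<forall>n. p n \<in> K"
  proof
    fix n show "p n \<in> K"
      using p(1-4)[of n] e(1)[of n] by (simp add: K_iff)
  qed
  then obtain l r where l: "l \<in> K" and r: "strict_mono r" and lim: "(p \<circ> r) \<longlonglongrightarrow> l"
    using compact_cbox[of "Complex (Re z) 0" "Complex (Re w) pi"]
    unfolding K_def[symmetric] compact_def by blast
  have pK: "p (r n) \<in> K" for n
    using \<open>\<forall>n. p n \<in> K\<close> by blast
  have K_sub: "K \<subseteq> {\<zeta>. 0 \<le> Im \<zeta> \<and> Im \<zeta> \<le> pi}"
    by (auto simp: K_iff)
  have limN: "(\<lambda>n. N (p (r n))) \<longlonglongrightarrow> N l" and limD: "(\<lambda>n. D (p (r n))) \<longlonglongrightarrow> D l"
    by (rule continuous_on_tendsto_compose[OF continuous_on_subset[OF cont_N K_sub] _ l]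
         continuous_on_tendsto_compose[OF continuous_on_subset[OF cont_D K_sub] _ l],
        use lim pK in \<open>auto simp: o_def\<close>)+
  have lim_Im: "(\<lambda>n. Im (p (r n))) \<longlonglongrightarrow> Im l"
    using tendsto_Im[OF lim] by (simp add: o_def)
  have lim_e: "(\<lambda>n. e (r n)) \<longlonglongrightarrow> 0"
    using LIMSEQ_subseq_LIMSEQ[OF e_lim r] by (simp add: o_def)
  have normN: "(\<lambda>n. cmod (N (p (r n)))) \<longlonglongrightarrow> cmod (N l)"
    and normD: "(\<lambda>n. cmod \<alpha> * cmod (D (p (r n)))) \<longlonglongrightarrow> cmod \<alpha> * cmod (D l)"
    by (intro tendsto_intros limN limD)+
  have "N l * cnj (D l) * \<alpha> \<in> \<real>\<^sub>\<ge>\<^sub>0"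
  proof (rule closed_sequentially[OF closed_nonneg_Reals_complex])
    show "(\<lambda>n. N (p (r n)) * cnj (D (p (r n))) * \<alpha>) \<longlonglongrightarrow> N l * cnj (D l) * \<alpha>"
      by (intro tendsto_intros limN limD)
  qed (use p(7) in blast)
  moreover have "Im l = pi \<or> cmod (N l) \<le> cmod \<alpha> * cmod (D l)"
  proof (cases "Im l = pi")
    \<comment> \<open>If the limit is off the upper edge, the approximating points are eventually
      below the clamp pi - e, which leaves the norm inequality.\<close>
    case False
    have "(\<lambda>n. Im (p (r n)) + e (r n)) \<longlonglongrightarrow> Im l + 0"
      by (intro tendsto_intros lim_Im lim_e)
    moreover have "Im l + 0 < pi"
      using False l by (auto simp: K_iff)
    ultimately have "\<forall>\<^sub>F n in sequentially. Im (p (r n)) + e (r n) < pi"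
      by (rule order_tendstoD)
    then have "\<forall>\<^sub>F n in sequentially. cmod (N (p (r n))) \<le> cmod \<alpha> * cmod (D (p (r n)))"
    proof (rule eventually_mono)
      show "cmod (N (p (r n))) \<le> cmod \<alpha> * cmod (D (p (r n)))" if "Im (p (r n)) + e (r n) < pi" for n
        using p(5)[of "r n"] that by auto
    qed
    then show ?thesis
      using tendsto_le[OF _ normD normN] by simp
  qed simp
  moreover have "Im l = 0 \<or> cmod \<alpha> * cmod (D l) \<le> cmod (N l)"
  proof (cases "Im l = 0")
    case False
    have "(\<lambda>n. Im (p (r n)) - e (r n)) \<longlonglongrightarrow> Im l - 0"
      by (intro tendsto_intros lim_Im lim_e)
    moreover have "Im l - 0 > 0"
      using False l by (auto simp: K_iff)
    ultimately have "\<forall>\<^sub>F n in sequentially. Im (p (r n)) - e (r n) > 0"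
      by (rule order_tendstoD)
    then have "\<forall>\<^sub>F n in sequentially. cmod \<alpha> * cmod (D (p (r n))) \<le> cmod (N (p (r n)))"
    proof (rule eventually_mono)
      show "cmod \<alpha> * cmod (D (p (r n))) \<le> cmod (N (p (r n)))" if "Im (p (r n)) - e (r n) > 0" for n
        using p(6)[of "r n"] that by auto
    qed
    then show ?thesis
      using tendsto_le[OF _ normN normD] by simp
  qed simp
  ultimately show ?thesis
    using that[of l] l by (auto simp: K_iff)
qed

text \<open>At the limiting level point an edge is impossible: there \<alpha> or \<alpha> exp (i
  \<beta>) would be real. In the open strip N / D has absolute value |\<alpha>| and a positive
  product with \<alpha>, so it equals \<open>cnj \<alpha>\<close>.\<close>

lemma conjugate_point_between:
  assumes zw: "z \<in> open_strip" "w \<in> open_strip" "Re z < Re w"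
    and eq: "N z = \<alpha> * D z" "N w = \<alpha> * D w"
    and \<alpha>: "\<alpha> \<notin> \<real>" "\<alpha> * exp (\<i> * of_real \<beta>) \<notin> \<real>"
  obtains p where "p \<in> open_strip" "Re z < Re p" "Re p < Re w" "N p = cnj \<alpha> * D p"
proof -
  obtain p where p: "Re z \<le> Re p" "Re p \<le> Re w" "0 \<le> Im p" "Im p \<le> pi"
    and le: "Im p = pi \<or> cmod (N p) \<le> cmod \<alpha> * cmod (D p)"
    and ge: "Im p = 0 \<or> cmod \<alpha> * cmod (D p) \<le> cmod (N p)"
    and pos: "N p * cnj (D p) * \<alpha> \<in> \<real>\<^sub>\<ge>\<^sub>0"
    using limiting_level_point[OF zw eq] by blast
  have \<alpha>0: "\<alpha> \<noteq> 0"
    using \<alpha> by auto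
  have "Im p \<noteq> 0"
  proof
    assume Im: "Im p = 0"
    \<comment> \<open>A zero of D would make N vanish by \<open>le\<close>, but N has no zeros on
      the lower edge.\<close>
    have "D p \<noteq> 0"
      using le lower_nonzero[OF Im] Im by auto
    then have nz: "N p * cnj (D p) \<noteq> 0"
      using lower_nonzero[OF Im] by simp
    have "N p * cnj (D p) * \<alpha> / (N p * cnj (D p)) \<in> \<real>"
      using lower_real[OF Im] pos nonneg_Reals_subset_Reals by (intro Reals_divide) auto
    then show False
      using nz \<alpha> by simp
  qed
  moreover have "Im p \<noteq> pi"
  proof
    assume Im: "Im p = pi"
    \<comment> \<open>D has no zeros on the upper edge, so \<open>ge\<close> bounds N away from
      0.\<close>
    have "N p \<noteq> 0"
      using ge upper_nonzero[OF Im] Im \<alpha>0 by (auto simp: mult_le_0_iff)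
    then have nz: "N p * cnj (D p) * exp (- \<i> * of_real \<beta>) \<noteq> 0"
      using upper_nonzero[OF Im] by simp
    have "N p * cnj (D p) * \<alpha> / (N p * cnj (D p) * exp (- \<i> * of_real \<beta>)) \<in> \<real>"
      using upper_real[OF Im] pos nonneg_Reals_subset_Reals by (intro Reals_divide) auto
    then have "\<alpha> / exp (- \<i> * of_real \<beta>) \<in> \<real>"
      using nz by simp
    then show False
      using \<alpha> by (simp add: exp_minus field_simps)
  qed
  ultimately have ps: "p \<in> open_strip" and norm_eq: "cmod (N p) = cmod \<alpha> * cmod (D p)"
    using p le ge by (auto simp: open_strip_def)
  have D0: "D p \<noteq> 0"
    by (rule D_nonzero[OF ps])
  define q where "q = N p / D p"
  have "cmod q = cmod \<alpha>"
    using norm_eq D0 by (simp add: q_def norm_divide)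
  have "N p * cnj (D p) * \<alpha> = q * \<alpha> * of_real ((cmod (D p))\<^sup>2)"
    unfolding complex_norm_square using D0 by (simp add: q_def)
  moreover have "N p * cnj (D p) * \<alpha> = of_real (cmod (N p * cnj (D p) * \<alpha>))"
    using pos by (auto elim!: nonneg_Reals_cases)
  moreover have "cmod (N p * cnj (D p) * \<alpha>) = cmod q * cmod \<alpha> * (cmod (D p))\<^sup>2"
    using norm_eq \<open>cmod q = cmod \<alpha>\<close> by (simp add: norm_mult power2_eq_square)
  ultimately have "q * \<alpha> * of_real ((cmod (D p))\<^sup>2) = of_real (cmod q * cmod \<alpha>) * of_real ((cmod (D p))\<^sup>2)"
    by (simp only: of_real_mult)
  then have "q * \<alpha> = of_real ((cmod \<alpha>)\<^sup>2)"
    using D0 \<open>cmod q = cmod \<alpha>\<close> by (simp add: power2_eq_square)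
  also have "\<dots> = cnj \<alpha> * \<alpha>"
    by (simp only: complex_norm_square mult.commute)
  finally have q: "q = cnj \<alpha>"
    using \<alpha>0 by simp
  have "cnj \<alpha> \<noteq> \<alpha>"
    using \<alpha> by (simp add: Reals_cnj_iff)
  \<comment> \<open>A solution with the real part of p has the same |exp F|, hence coincides with p,
    although the values \<alpha> and \<open>cnj \<alpha>\<close> differ. This makes the bounds on Re
    p strict.\<close>
  have "Re p \<noteq> Re x" if x: "x \<in> open_strip" "N x = \<alpha> * D x" for x
  proof
    assume "Re p = Re x"
    have "exp (F p) = q" "exp (F x) = \<alpha>"
      using N_eq[OF ps] N_eq[OF x(1)] D0 D_nonzero[OF x(1)] x(2) by (auto simp: q_def)
    moreover from this have "Re (F p) = Re (F x)"
      using \<open>cmod q = cmod \<alpha>\<close> by (metis exp_inj_iff norm_exp_eq_Re)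
    ultimately show False
      using Re_eq_imp_eq[OF ps x(1) \<open>Re p = Re x\<close>] q \<open>cnj \<alpha> \<noteq> \<alpha>\<close> by auto
  qed
  then have "Re z < Re p" "Re p < Re w"
    using p zw eq by force+
  moreover have "N p = cnj \<alpha> * D p"
    using q D0 by (simp add: q_def field_simps)
  ultimately show ?thesis
    using that ps by blast
qed

end

section \<open>W in the logarithmic variable\<close>

text \<open>\<open>nontrivial\<close> stands for the condition that W is not identically z^B, in
  terms of the parameters.\<close>

locale W_data =
  fixes A A0 B :: real
    and Na Nb Nc Nd :: "nat set"
    and a b c d :: "nat \<Rightarrow> real"
    and k l kt lt :: "nat \<Rightarrow> nat"
  assumes A_nonneg: "A \<ge> 0" and A0_nonneg: "A0 \<ge> 0"
    and prod_a: "negative_zero_product Na a k"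
    and prod_b: "negative_zero_product Nb b l"
    and prod_c: "negative_zero_product Nc c kt"
    and prod_d: "negative_zero_product Nd d lt"
    and nontrivial: "A \<noteq> 0 \<or> A0 \<noteq> 0 \<or> Na \<noteq> {} \<or> Nb \<noteq> {} \<or> Nc \<noteq> {} \<or> Nd \<noteq> {}"
begin

sublocale pa: negative_zero_product Na a k by (rule prod_a)
sublocale pb: negative_zero_product Nb b l by (rule prod_b)
sublocale pc: negative_zero_product Nc c kt by (rule prod_c)
sublocale pd: negative_zero_product Nd d lt by (rule prod_d)

abbreviation Wu :: "complex \<Rightarrow> complex" where
  "Wu \<equiv> W_upper A A0 B Na a k Nb b l Nc c kt Nd d lt"

text \<open>A logarithm of exp (A z + A0 / z) z^B at z = exp \<zeta>; the term B \<zeta> involves no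
  choice of branch.\<close>

definition exponent :: "complex \<Rightarrow> complex" where
  "exponent \<zeta> = of_real A * exp \<zeta> + of_real A0 * exp (- \<zeta>) + of_real B * \<zeta>"

text \<open>\<open>N\<close> and \<open>D\<close> are numerator and denominator of W at z = exp
  \<zeta>, both entire. The factors 1 - z/b are those of \<open>pb.E\<close> at -z, whence the minus
  signs in \<open>D\<close>.\<close>

definition N :: "complex \<Rightarrow> complex" where
  "N \<zeta> = exp (exponent \<zeta>) * pa.E (exp \<zeta>) * pc.E (exp (- \<zeta>))"

definition D :: "complex \<Rightarrow> complex" where
  "D \<zeta> = pb.E (- exp \<zeta>) * pd.E (- exp (- \<zeta>))"

text \<open>Up to and including Im \<zeta> = pi the principal logarithm inverts exp, so the
  principal power is exp (B \<zeta>), also for the values from above on the negative axis.\<close>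

lemma Wu_exp:
  assumes "0 \<le> Im \<zeta>" "Im \<zeta> \<le> pi"
  shows "Wu (exp \<zeta>) = N \<zeta> / D \<zeta>"
proof -
  have "Ln (exp \<zeta>) = \<zeta>"
    using assms pi_gt_zero by (intro Ln_exp) linarith+
  then have "exp \<zeta> powr of_real B = exp (of_real B * \<zeta>)"
    by (simp add: powr_def)
  moreover have "1 / (exp \<zeta> * w) = exp (- \<zeta>) / w" for w
    by (simp add: exp_minus divide_inverse)
  ultimately show ?thesis
    unfolding W_upper_def N_def D_def exponent_def pa.E_def pb.E_def pc.E_def pd.E_def
    by (simp add: exp_add exp_minus divide_inverse)
qed

text \<open>The logarithmic derivative of N / D. A product evaluated at w contributes w E'(w) /
  E(w), with one sign change if w contains exp (-\<zeta>) and another if it belongs to D.\<close>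

definition F' :: "complex \<Rightarrow> complex" where
  "F' \<zeta> = of_real A * exp \<zeta> - of_real A0 * exp (- \<zeta>) + of_real B
    + exp \<zeta> * deriv pa.E (exp \<zeta>) / pa.E (exp \<zeta>)
    - exp (- \<zeta>) * deriv pc.E (exp (- \<zeta>)) / pc.E (exp (- \<zeta>))
    - ((- exp \<zeta>) * deriv pb.E (- exp \<zeta>) / pb.E (- exp \<zeta>)
       - (- exp (- \<zeta>)) * deriv pd.E (- exp (- \<zeta>)) / pd.E (- exp (- \<zeta>)))"

lemma Im_exp_strip:
  assumes "\<zeta> \<in> open_strip"
  shows "Im (exp \<zeta>) > 0" "Im (exp (- \<zeta>)) < 0"
  using assms sin_gt_zero[of "Im \<zeta>"] by (auto simp: open_strip_def Im_exp)

lemma factors_nonzero: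
  assumes "\<zeta> \<in> open_strip"
  shows "pa.E (exp \<zeta>) \<noteq> 0" "pb.E (- exp \<zeta>) \<noteq> 0" "pc.E (exp (- \<zeta>)) \<noteq> 0" "pd.E (- exp (- \<zeta>)) \<noteq> 0"
  using Im_exp_strip[OF assms]
  by (auto intro!: pa.E_nonzero pb.E_nonzero pc.E_nonzero pd.E_nonzero simp: complex_nonpos_Reals_iff)

text \<open>The imaginary part of w E'(w) / E(w) has the sign of Im w or is 0. Exactly the products
  evaluated in the lower half-plane, at exp (-\<zeta>) and - exp \<zeta>, enter F' with a minus
  sign, so every term is nonnegative; B is real, and \<open>nontrivial\<close> supplies a positive
  term.\<close>

lemma Im_F'_pos:
  assumes "\<zeta> \<in> open_strip"
  shows "Im (F' \<zeta>) > 0"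
proof -
  note I = Im_exp_strip[OF assms]
  let ?LE = "\<lambda>E w. Im (w * deriv E w / E w)"
  have nz: "Im (exp \<zeta>) \<noteq> 0" "Im (exp (- \<zeta>)) \<noteq> 0" "Im (- exp \<zeta>) \<noteq> 0" "Im (- exp (- \<zeta>)) \<noteq> 0"
    using I by auto
  have ge: "?LE pa.E (exp \<zeta>) \<ge> 0" "?LE pc.E (exp (- \<zeta>)) \<le> 0"
      "?LE pb.E (- exp \<zeta>) \<le> 0" "?LE pd.E (- exp (- \<zeta>)) \<ge> 0"
    using pa.E_logderiv_nonneg[OF nz(1)] pc.E_logderiv_nonneg[OF nz(2)]
      pb.E_logderiv_nonneg[OF nz(3)] pd.E_logderiv_nonneg[OF nz(4)] I
    by (auto simp only: zero_le_mult_iff uminus_complex.sel)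
  have pos: "0 < x * y \<Longrightarrow> 0 < x \<Longrightarrow> 0 < y" and neg: "0 < x * y \<Longrightarrow> x < 0 \<Longrightarrow> y < 0" for x y :: real
    by (auto simp: zero_less_mult_iff)
  have gt: "Na \<noteq> {} \<Longrightarrow> ?LE pa.E (exp \<zeta>) > 0" "Nc \<noteq> {} \<Longrightarrow> ?LE pc.E (exp (- \<zeta>)) < 0"
      "Nb \<noteq> {} \<Longrightarrow> ?LE pb.E (- exp \<zeta>) < 0" "Nd \<noteq> {} \<Longrightarrow> ?LE pd.E (- exp (- \<zeta>)) > 0"
    using pos[OF pa.E_logderiv_pos[OF nz(1)] I(1)] neg[OF pc.E_logderiv_pos[OF nz(2)] I(2)]
      neg[OF pb.E_logderiv_pos[OF nz(3)]] pos[OF pd.E_logderiv_pos[OF nz(4)]] I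
    by simp_all
  have "A * Im (exp \<zeta>) \<ge> 0" "A0 * Im (exp (- \<zeta>)) \<le> 0"
    using I A_nonneg A0_nonneg by (auto simp: mult_nonneg_nonpos)
  moreover have "A \<noteq> 0 \<Longrightarrow> A * Im (exp \<zeta>) > 0" "A0 \<noteq> 0 \<Longrightarrow> A0 * Im (exp (- \<zeta>)) < 0"
    using I A_nonneg A0_nonneg by (auto simp: mult_pos_neg)
  moreover have "Im (F' \<zeta>) = A * Im (exp \<zeta>) - A0 * Im (exp (- \<zeta>)) + ?LE pa.E (exp \<zeta>)
     - ?LE pc.E (exp (- \<zeta>)) - (?LE pb.E (- exp \<zeta>) - ?LE pd.E (- exp (- \<zeta>)))"
    unfolding F'_def by (simp only: plus_complex.sel minus_complex.sel Im_complex_of_real) simp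
  ultimately show ?thesis
    using ge gt nontrivial by linarith
qed

text \<open>Derivatives are kept as function times logarithmic derivative; in this form products add
  and quotients subtract.\<close>

lemma log_deriv_mult:
  fixes f g :: "complex \<Rightarrow> complex"
  assumes "(f has_field_derivative f z * p) (at z)" "(g has_field_derivative g z * q) (at z)"
  shows "((\<lambda>z. f z * g z) has_field_derivative (f z * g z) * (p + q)) (at z)"
  by (rule DERIV_cong[OF DERIV_mult[OF assms]]) (simp add: algebra_simps)

lemma log_deriv_divide:
  fixes f g :: "complex \<Rightarrow> complex"
  assumes "(f has_field_derivative f z * p) (at z)" "(g has_field_derivative g z * q) (at z)" "g z \<noteq> 0"
  shows "((\<lambda>z. f z / g z) has_field_derivative (f z / g z) * (p - q)) (at z)"
  by (rule DERIV_cong[OF DERIV_divide[OF assms]]) (use assms(3) in \<open>simp add: field_simps\<close>)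

lemma log_deriv_compose:
  fixes E g :: "complex \<Rightarrow> complex"
  assumes "(E has_field_derivative E') (at (g z))" "(g has_field_derivative g') (at z)" "E (g z) \<noteq> 0"
  shows "((\<lambda>z. E (g z)) has_field_derivative E (g z) * (g' * E' / E (g z))) (at z)"
  by (rule DERIV_cong[OF DERIV_chain2[OF assms(1,2)]]) (use assms(3) in simp)

lemma quotient_deriv:
  assumes "\<zeta> \<in> open_strip"
  shows "((\<lambda>\<zeta>. N \<zeta> / D \<zeta>) has_field_derivative (N \<zeta> / D \<zeta>) * F' \<zeta>) (at \<zeta>)"
proof -
  note nz = factors_nonzero[OF assms]
  have e: "(exp has_field_derivative exp \<zeta>) (at \<zeta>)"
    and me: "((\<lambda>\<zeta>. exp (- \<zeta>)) has_field_derivative - exp (- \<zeta>)) (at \<zeta>)"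
    and ne: "((\<lambda>\<zeta>. - exp \<zeta>) has_field_derivative - exp \<zeta>) (at \<zeta>)"
    and nme: "((\<lambda>\<zeta>. - exp (- \<zeta>)) has_field_derivative exp (- \<zeta>)) (at \<zeta>)"
    by (auto intro!: derivative_eq_intros)
  have x: "(exponent has_field_derivative of_real A * exp \<zeta> - of_real A0 * exp (- \<zeta>) + of_real B) (at \<zeta>)"
    unfolding exponent_def by (auto intro!: derivative_eq_intros)
  have "((\<lambda>\<zeta>. N \<zeta> / D \<zeta>) has_field_derivative (N \<zeta> / D \<zeta>) *
     (((of_real A * exp \<zeta> - of_real A0 * exp (- \<zeta>) + of_real B)
       + exp \<zeta> * deriv pa.E (exp \<zeta>) / pa.E (exp \<zeta>)
       + (- exp (- \<zeta>)) * deriv pc.E (exp (- \<zeta>)) / pc.E (exp (- \<zeta>)))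
     - ((- exp \<zeta>) * deriv pb.E (- exp \<zeta>) / pb.E (- exp \<zeta>)
        + exp (- \<zeta>) * deriv pd.E (- exp (- \<zeta>)) / pd.E (- exp (- \<zeta>))))) (at \<zeta>)"
    unfolding N_def D_def
    by (intro log_deriv_divide log_deriv_mult DERIV_chain2[OF DERIV_exp x]
        log_deriv_compose[OF pa.E_derivative(1) e] log_deriv_compose[OF pc.E_derivative(1) me]
        log_deriv_compose[OF pb.E_derivative(1) ne] log_deriv_compose[OF pd.E_derivative(1) nme] nz)
      (use nz in simp)
  then show ?thesis
    by (rule DERIV_cong) (simp add: F'_def)
qed

lemma N_nonzero_strip: "\<zeta> \<in> open_strip \<Longrightarrow> N \<zeta> \<noteq> 0"
  and D_nonzero_strip: "\<zeta> \<in> open_strip \<Longrightarrow> D \<zeta> \<noteq> 0"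
  using factors_nonzero by (auto simp: N_def D_def)

text \<open>N / D is holomorphic and zero-free on a convex open set, so it has a logarithm g.
  Comparing exp g * g' with (N / D) F' yields g' = F'.\<close>

lemma log_exists:
  "\<exists>F. \<forall>\<zeta>\<in>open_strip. N \<zeta> = D \<zeta> * exp (F \<zeta>) \<and> (F has_field_derivative F' \<zeta>) (at \<zeta>)"
proof -
  let ?M = "\<lambda>\<zeta>. N \<zeta> / D \<zeta>"
  have i: "\<i> \<in> open_strip"
    using pi_gt3 by (auto simp: open_strip_def)
  have "?M holomorphic_on open_strip"
    using quotient_deriv by (auto simp: holomorphic_on_open[OF open_open_strip])
  then obtain g where g: "g holomorphic_on open_strip" "\<And>\<zeta>. \<zeta> \<in> open_strip \<Longrightarrow> exp (g \<zeta>) = ?M \<zeta>"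
    using holomorphic_logarithm_exists[OF convex_open_strip open_open_strip _ _ i, of ?M]
      N_nonzero_strip D_nonzero_strip by auto
  have "N \<zeta> = D \<zeta> * exp (g \<zeta>) \<and> (g has_field_derivative F' \<zeta>) (at \<zeta>)" if s: "\<zeta> \<in> open_strip" for \<zeta>
  proof -
    have dg: "(g has_field_derivative deriv g \<zeta>) (at \<zeta>)"
      by (rule holomorphic_derivI[OF g(1) open_open_strip s])
    have "(?M has_field_derivative exp (g \<zeta>) * deriv g \<zeta>) (at \<zeta>)"
      by (rule has_field_derivative_transform_within_open[OF DERIV_chain2[OF DERIV_exp dg] open_open_strip s])
        (use g(2) in auto)
    then have "exp (g \<zeta>) * deriv g \<zeta> = ?M \<zeta> * F' \<zeta>"
      by (rule DERIV_unique) (rule quotient_deriv[OF s])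
    then have "deriv g \<zeta> = F' \<zeta>"
      unfolding g(2)[OF s, symmetric] by simp
    then show ?thesis
      using dg g(2)[OF s] D_nonzero_strip[OF s] by simp
  qed
  then show ?thesis
    by blast
qed

definition F :: "complex \<Rightarrow> complex" where
  "F = (SOME F. \<forall>\<zeta>\<in>open_strip. N \<zeta> = D \<zeta> * exp (F \<zeta>) \<and> (F has_field_derivative F' \<zeta>) (at \<zeta>))"

lemma F:
  assumes "\<zeta> \<in> open_strip"
  shows "N \<zeta> = D \<zeta> * exp (F \<zeta>)" "(F has_field_derivative F' \<zeta>) (at \<zeta>)"
  using someI_ex[OF log_exists] assms unfolding F_def[symmetric] by auto

text \<open>Here exp \<zeta> and exp (-\<zeta>) are positive: every factor is real, and
  \<open>pa.E\<close> and \<open>pc.E\<close> have only negative zeros.\<close>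

lemma lower_edge:
  assumes "Im \<zeta> = 0"
  shows "N \<zeta> \<noteq> 0" "N \<zeta> \<in> \<real>" "D \<zeta> \<in> \<real>"
proof -
  obtain s where [simp]: "\<zeta> = of_real s"
    using assms by (metis complex_is_Real_iff Reals_cases)
  have "pa.E (exp \<zeta>) \<noteq> 0" "pc.E (exp (- \<zeta>)) \<noteq> 0"
    by (auto intro!: pa.E_nonzero pc.E_nonzero simp: complex_nonpos_Reals_iff Re_exp not_le)
  then show "N \<zeta> \<noteq> 0"
    by (simp add: N_def)
  have r: "exp \<zeta> \<in> \<real>" "exp (- \<zeta>) \<in> \<real>"
    by (auto simp: complex_is_Real_iff Im_exp)
  moreover have "exp (exponent \<zeta>) \<in> \<real>"
    by (auto simp: complex_is_Real_iff Im_exp exponent_def)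
  ultimately show "N \<zeta> \<in> \<real>" "D \<zeta> \<in> \<real>"
    by (auto simp: N_def D_def intro!: Reals_mult pa.E_real pb.E_real pc.E_real pd.E_real)
qed

text \<open>Here exp \<zeta> is negative, so \<open>pb.E\<close> and \<open>pd.E\<close> are
  evaluated at positive points. Only exp (B \<zeta>) can be nonreal, and its phase B pi is divided
  out.\<close>

lemma upper_edge:
  assumes "Im \<zeta> = pi"
  shows "D \<zeta> \<noteq> 0" "N \<zeta> * exp (- \<i> * of_real (B * pi)) \<in> \<real>" "D \<zeta> \<in> \<real>"
proof -
  have r: "exp \<zeta> = - of_real (exp (Re \<zeta>))" "exp (- \<zeta>) = - of_real (exp (- Re \<zeta>))"
    using assms by (auto simp: complex_eq_iff Re_exp Im_exp)
  have "pb.E (- exp \<zeta>) \<noteq> 0" "pd.E (- exp (- \<zeta>)) \<noteq> 0"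
    unfolding r by (auto intro!: pb.E_nonzero pd.E_nonzero simp: complex_nonpos_Reals_iff Re_exp not_le)
  then show "D \<zeta> \<noteq> 0"
    by (simp add: D_def)
  have real: "exp \<zeta> \<in> \<real>" "exp (- \<zeta>) \<in> \<real>"
    unfolding r by (auto intro!: Reals_minus)
  have "Im (exponent \<zeta> - \<i> * of_real (B * pi)) = 0"
    using assms by (simp add: exponent_def r Im_exp del: of_real_exp)
  then have "exp (exponent \<zeta> - \<i> * of_real (B * pi)) \<in> \<real>"
    by (simp add: complex_is_Real_iff Im_exp)
  then have "exp (exponent \<zeta> - \<i> * of_real (B * pi)) * pa.E (exp \<zeta>) * pc.E (exp (- \<zeta>)) \<in> \<real>"
    using real by (intro Reals_mult pa.E_real pc.E_real)
  then show "N \<zeta> * exp (- \<i> * of_real (B * pi)) \<in> \<real>"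
    by (simp add: N_def exp_diff exp_minus field_simps)
  show "D \<zeta> \<in> \<real>"
    unfolding D_def using real by (intro Reals_mult pb.E_real pd.E_real Reals_minus)
qed

lemma continuous_N: "continuous_on S N"
  unfolding N_def exponent_def
  by (intro continuous_intros
      continuous_on_compose2[OF holomorphic_on_imp_continuous_on[OF pa.E_holomorphic[of UNIV]]]
      continuous_on_compose2[OF holomorphic_on_imp_continuous_on[OF pc.E_holomorphic[of UNIV]]]) auto

lemma continuous_D: "continuous_on S D"
  unfolding D_def
  by (intro continuous_intros
      continuous_on_compose2[OF holomorphic_on_imp_continuous_on[OF pb.E_holomorphic[of UNIV]]]
      continuous_on_compose2[OF holomorphic_on_imp_continuous_on[OF pd.E_holomorphic[of UNIV]]]) auto

sublocale strip: strip_quotient N D F F' "B * pi"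
proof
  show "N \<zeta> * cnj (D \<zeta>) \<in> \<real>" if "Im \<zeta> = 0" for \<zeta>
    using lower_edge[OF that] by (auto simp: Reals_cnj_iff)
  show "N \<zeta> * cnj (D \<zeta>) * exp (- \<i> * of_real (B * pi)) \<in> \<real>" if "Im \<zeta> = pi" for \<zeta>
  proof -
    have "N \<zeta> * exp (- \<i> * of_real (B * pi)) * D \<zeta> \<in> \<real>"
      by (intro Reals_mult upper_edge[OF that])
    moreover have "cnj (D \<zeta>) = D \<zeta>"
      using upper_edge(3)[OF that] by (simp add: Reals_cnj_iff)
    ultimately show ?thesis
      by (simp only: mult_ac)
  qed
qed (use continuous_N continuous_D D_nonzero_strip F Im_F'_pos lower_edge(1) upper_edge(1) in auto)

lemma Ln_strip:
  assumes "Im z > 0"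
  shows "Ln z \<in> open_strip" "exp (Ln z) = z" "Re (Ln z) = ln (cmod z)"
proof -
  have "z \<noteq> 0"
    using assms by auto
  then show "exp (Ln z) = z" "Re (Ln z) = ln (cmod z)"
    by auto
  show "Ln z \<in> open_strip"
    using assms Im_Ln_pos_lt_imp[of z] by (auto simp: open_strip_def)
qed

lemma Wu_Ln:
  assumes "Im z > 0"
  shows "Wu z = N (Ln z) / D (Ln z)" "Wu z = exp (F (Ln z))"
proof -
  show "Wu z = N (Ln z) / D (Ln z)"
    using Wu_exp[of "Ln z"] Ln_strip[OF assms] by (simp add: open_strip_def)
  then show "Wu z = exp (F (Ln z))"
    using F(1) D_nonzero_strip Ln_strip[OF assms] by simp
qed

lemma Wu_eq_iff: "Im z > 0 \<Longrightarrow> Wu z = \<gamma> \<longleftrightarrow> N (Ln z) = \<gamma> * D (Ln z)"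
  using Wu_Ln(1) D_nonzero_strip[OF Ln_strip(1)] by (simp add: nonzero_divide_eq_eq)

text \<open>W is exp (F (Ln z)), and F' has positive imaginary part, so no factor of the chain rule
  vanishes.\<close>

lemma Wu_deriv:
  assumes "Im z > 0"
  obtains w where "w \<noteq> 0" "(Wu has_field_derivative w) (at z)"
proof
  note s = Ln_strip[OF assms]
  have z: "z \<notin> \<real>\<^sub>\<le>\<^sub>0" "z \<noteq> 0"
    using assms by (auto simp: complex_nonpos_Reals_iff)
  have "((\<lambda>z. exp (F (Ln z))) has_field_derivative exp (F (Ln z)) * (F' (Ln z) * inverse z)) (at z)"
    by (intro DERIV_chain2[OF DERIV_exp] DERIV_chain2[where f = F and g = Ln, OF F(2)[OF s(1)]] has_field_derivative_Ln z)
  then show "(Wu has_field_derivative exp (F (Ln z)) * (F' (Ln z) * inverse z)) (at z)"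
    by (rule has_field_derivative_transform_within_open[OF _ open_halfspace_Im_gt[of 0]])
      (use assms Wu_Ln(2) in auto)
  have "F' (Ln z) \<noteq> 0"
    using Im_F'_pos[OF s(1)] by auto
  then show "exp (F (Ln z)) * (F' (Ln z) * inverse z) \<noteq> 0"
    using z by simp
qed

text \<open>Equal absolute values of z and w mean equal real parts of their logarithms. Comparing
  only |W| also covers a pair with values \<alpha> and \<open>cnj \<alpha>\<close>.\<close>

lemma Wu_distinct:
  assumes "Im z > 0" "Im w > 0" "cmod (Wu z) = cmod (Wu w)" "cmod z = cmod w"
  shows "z = w"
proof -
  have "Re (F (Ln z)) = Re (F (Ln w))"
    using assms(3) by (simp add: Wu_Ln(2) assms)
  then have "Ln z = Ln w"
    using strip.Re_eq_imp_eq Ln_strip assms by metis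
  then show ?thesis
    using Ln_strip(2) assms by metis
qed

text \<open>Applied with \<gamma> = \<alpha> to pairs in the upper half-plane and with \<gamma> =
  \<open>cnj \<alpha>\<close> to mirrored pairs from the lower one.\<close>

lemma Wu_between:
  assumes "Im z > 0" "Im w > 0" "cmod z < cmod w" "Wu z = \<gamma>" "Wu w = \<gamma>"
    and "\<gamma> \<notin> \<real>" "\<gamma> * exp (\<i> * of_real (B * pi)) \<notin> \<real>"
  obtains u where "Im u > 0" "cmod z < cmod u" "cmod u < cmod w" "Wu u = cnj \<gamma>"
proof -
  have nz: "cmod z > 0" "cmod w > 0"
    using assms by auto
  have "Re (Ln z) < Re (Ln w)"
    using assms nz by (simp add: Ln_strip)
  then obtain p where p: "p \<in> open_strip" "Re (Ln z) < Re p" "Re p < Re (Ln w)" "N p = cnj \<gamma> * D p"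
    using strip.conjugate_point_between[of "Ln z" "Ln w" \<gamma>] assms Ln_strip Wu_eq_iff by metis
  have "Wu (exp p) = cnj \<gamma>"
    using p D_nonzero_strip Wu_exp[of p] by (simp add: open_strip_def)
  moreover have "cmod z < exp (Re p)" "exp (Re p) < cmod w"
    using p(2,3) nz assms Ln_strip by (metis exp_less_cancel_iff exp_ln)+
  ultimately show ?thesis
    using that[of "exp p"] Im_exp_strip[OF p(1)] by simp
qed

lemma Wu_positive_real: "x > 0 \<Longrightarrow> Wu (of_real x) \<in> \<real>"
  using Wu_exp[of "of_real (ln x)"] lower_edge[of "of_real (ln x)"]
  by (simp add: exp_of_real)

lemma Wu_negative_real:
  assumes "x > 0"
  shows "Wu (of_real (- x)) * exp (- \<i> * of_real (B * pi)) \<in> \<real>"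
proof -
  let ?\<zeta> = "of_real (ln x) + \<i> * of_real pi"
  have "exp ?\<zeta> = of_real (- x)"
    using assms by (simp add: exp_add exp_of_real)
  then have "Wu (of_real (- x)) * exp (- \<i> * of_real (B * pi))
     = N ?\<zeta> * exp (- \<i> * of_real (B * pi)) / D ?\<zeta>"
    using Wu_exp[of ?\<zeta>] by simp
  also have "\<dots> \<in> \<real>"
    by (intro Reals_divide upper_edge) simp_all
  finally show ?thesis .
qed

text \<open>The branch cut of Ln is avoided by writing the logarithm of -x + iy as Ln (x - iy) + i
  pi, which is continuous at y = 0 and lies in the closed strip for y \<ge> 0. D is nonzero on the
  upper edge, so N / D is continuous there.\<close>

lemma Wu_limit_negative:
  assumes "x > 0"
  shows "((\<lambda>y. Wu (Complex (- x) y)) \<longlongrightarrow> Wu (of_real (- x))) (at_right 0)"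
proof -
  have eq: "Wu (Complex (- x) y) = N (Ln (Complex x (- y)) + \<i> * of_real pi) / D (Ln (Complex x (- y)) + \<i> * of_real pi)"
    if "y \<ge> 0" for y
  proof -
    let ?z = "Complex x (- y)"
    have z: "?z \<noteq> 0"
      using assms by (auto simp: complex_eq_iff)
    have "\<bar>Im (Ln ?z)\<bar> < pi / 2"
      using Re_Ln_pos_lt[OF z] assms by simp
    moreover have "Im (Ln ?z) \<le> 0"
      using that assms z Im_Ln_pos_lt[OF z] calculation by (cases "y = 0") (auto simp: not_less)
    ultimately have "Wu (exp (Ln ?z + \<i> * of_real pi)) = N (Ln ?z + \<i> * of_real pi) / D (Ln ?z + \<i> * of_real pi)"
      by (intro Wu_exp) auto
    moreover have "exp (Ln ?z + \<i> * of_real pi) = Complex (- x) y"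
      using z by (simp add: exp_add complex_eq_iff)
    ultimately show ?thesis
      by simp
  qed
  have D0: "D (Ln (Complex x 0) + \<i> * of_real pi) \<noteq> 0"
    using assms by (intro upper_edge(1)) (simp add: Complex_eq)
  have cN: "isCont N w" and cD: "isCont D w" for w
    using continuous_N[of UNIV] continuous_D[of UNIV] by (auto simp: continuous_on_eq_continuous_at)
  have "((\<lambda>y. Complex x (- y)) \<longlongrightarrow> Complex x (- 0)) (at_right 0)"
    by (intro tendsto_intros)
  then have L: "((\<lambda>y. Ln (Complex x (- y)) + \<i> * of_real pi) \<longlongrightarrow> Ln (Complex x 0) + \<i> * of_real pi) (at_right 0)"
    using assms by (intro tendsto_add tendsto_const tendsto_Ln) (auto simp: complex_nonpos_Reals_iff)
  have "((\<lambda>y. N (Ln (Complex x (- y)) + \<i> * of_real pi) / D (Ln (Complex x (- y)) + \<i> * of_real pi))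
    \<longlongrightarrow> N (Ln (Complex x 0) + \<i> * of_real pi) / D (Ln (Complex x 0) + \<i> * of_real pi)) (at_right 0)"
    by (intro tendsto_divide isCont_tendsto_compose[OF cN L] isCont_tendsto_compose[OF cD L] D0)
  also have "N (Ln (Complex x 0) + \<i> * of_real pi) / D (Ln (Complex x 0) + \<i> * of_real pi) = Wu (of_real (- x))"
    using eq[of 0] by (simp add: Complex_eq)
  finally show ?thesis
    by (rule Lim_transform_eventually) (auto simp: eventually_at_right_less eq intro!: eventually_at_rightI[of 0 1])
qed

end

section \<open>The theorem on both half-planes\<close>

text \<open>By contraposition this yields \<open>nontrivial\<close>. In the lower half-plane the
  reflected principal power is again the principal power.\<close>

lemma trivial_W_eq_powr:
  assumes "Im z \<noteq> 0"
  shows "W_fun 0 0 B {} a k {} b l {} c kt {} d lt z = z powr of_real B"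
proof (cases "Im z \<ge> 0")
  case False
  then show ?thesis
    using cnj_powr[of "cnj z" "of_real B"] assms by (simp add: W_fun_def W_upper_def indexed_prod_def)
qed (simp add: W_fun_def W_upper_def indexed_prod_def)

theorem theorem14:
  fixes A A0 B :: real
    and Na Nb Nc Nd :: "nat set"
    and a b c d :: "nat \<Rightarrow> real"
    and k l kt lt :: "nat \<Rightarrow> nat"
    and W :: "complex \<Rightarrow> complex"
    and \<alpha> :: complex
  assumes "A \<ge> 0" and "A0 \<ge> 0"
    and "\<forall>n\<in>Na. a n > 0" and "\<forall>n\<in>Nb. b n > 0"
    and "\<forall>n\<in>Nc. c n > 0" and "\<forall>n\<in>Nd. d n > 0"
    and "\<forall>n\<in>Na. k n > 0" and "\<forall>n\<in>Nb. l n > 0"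
    and "\<forall>n\<in>Nc. kt n > 0" and "\<forall>n\<in>Nd. lt n > 0"
    and "(\<lambda>n. real (k n) / a n) summable_on Na"
    and "(\<lambda>n. real (l n) / b n) summable_on Nb"
    and "(\<lambda>n. real (kt n) / c n) summable_on Nc"
    and "(\<lambda>n. real (lt n) / d n) summable_on Nd"
    and "W = W_fun A A0 B Na a k Nb b l Nc c kt Nd d lt"
    and "\<exists>z. Im z \<noteq> 0 \<and> W z \<noteq> z powr of_real B"
    and "\<alpha> \<notin> \<real>"
    and "\<alpha> * exp (\<i> * of_real (B * pi)) \<notin> \<real>"
    and "\<alpha> * exp (- \<i> * of_real (B * pi)) \<notin> \<real>"
  shows "(\<forall>z\<in>alpha_set W \<alpha>. Im z \<noteq> 0 \<longrightarrow>
            simple_point W z \<and> (\<forall>w\<in>alpha_set W \<alpha>. w \<noteq> z \<longrightarrow> cmod w \<noteq> cmod z))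
       \<and> (\<forall>z w. consecutive_in (alpha_set W \<alpha>) z w \<longrightarrow> Im z * Im w < 0)
       \<and> (\<forall>x>0. W (of_real x) \<noteq> \<alpha> \<and> W_plus W (- x) \<noteq> \<alpha> \<and> W_minus W (- x) \<noteq> \<alpha>)"
proof -
  have trivial: "\<not> (A = 0 \<and> A0 = 0 \<and> Na = {} \<and> Nb = {} \<and> Nc = {} \<and> Nd = {})"
    using assms(15,16) trivial_W_eq_powr by auto
  interpret W_data A A0 B Na Nb Nc Nd a b c d k l kt lt
    using assms(1-14) trivial by unfold_locales (auto simp: negative_zero_product_def)
  have W_up: "W z = Wu z" if "Im z \<ge> 0" for z
    using that by (simp add: assms(15) W_fun_def)
  have W_down: "W z = cnj (Wu (cnj z))" if "Im z < 0" for z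
    using that by (simp add: assms(15) W_fun_def)
  have \<alpha>: "\<alpha> \<notin> \<real>" "\<alpha> * exp (\<i> * of_real (B * pi)) \<notin> \<real>" "cnj \<alpha> \<noteq> \<alpha>"
    using assms(17,18) by (auto simp: Reals_cnj_iff)
  \<comment> \<open>Conjugation interchanges the conditions with i B pi and - i B pi, so
    \<open>cnj \<alpha>\<close> is admissible too.\<close>
  have cnj_\<alpha>: "cnj \<alpha> \<notin> \<real>" "cnj \<alpha> * exp (\<i> * of_real (B * pi)) \<notin> \<real>"
  proof -
    have "cnj (cnj \<alpha> * exp (\<i> * of_real (B * pi))) = \<alpha> * exp (- \<i> * of_real (B * pi))"
      by (simp add: exp_cnj)
    then show "cnj \<alpha> \<notin> \<real>" "cnj \<alpha> * exp (\<i> * of_real (B * pi)) \<notin> \<real>"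
      using assms(17,19) by (metis complex_cnj_cnj Reals_cnj_iff)+
  qed
  have pos_axis: "W (of_real x) \<noteq> \<alpha>" if "x > 0" for x
    using Wu_positive_real[OF that] \<alpha>(1) W_up[of "of_real x"] by auto
  \<comment> \<open>The value from above is a real multiple of exp (i B pi). Equality with \<alpha>
    contradicts the condition with - i B pi, equality with \<open>cnj \<alpha>\<close> the one with
    i B pi.\<close>
  have neg_axis: "Wu (of_real (- x)) \<noteq> \<alpha>" "Wu (of_real (- x)) \<noteq> cnj \<alpha>" if "x > 0" for x
  proof -
    have "exp (- \<i> * of_real (B * pi)) = cnj (exp (\<i> * of_real (B * pi)))"
      by (simp add: exp_cnj)
    then show "Wu (of_real (- x)) \<noteq> \<alpha>" "Wu (of_real (- x)) \<noteq> cnj \<alpha>"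
      using Wu_negative_real[OF that] assms(18,19)
      by (auto simp: Reals_cnj_iff)
  qed
  have nonreal: "Im z \<noteq> 0" if "W z = \<alpha>" for z
  proof
    assume "Im z = 0"
    then obtain x where z: "z = of_real x"
      by (metis complex_is_Real_iff Reals_cases)
    \<comment> \<open>At the origin \<open>0 powr _ = 0\<close> makes the value 0, which differs
      from the nonreal \<alpha>.\<close>
    have "W 0 = 0"
      by (simp add: W_up W_upper_def)
    then show False
      using pos_axis[of x] neg_axis(1)[of "- x"] W_up[of z] that z \<alpha>(1)
      by (cases x "0 :: real" rule: linorder_cases) auto
  qed
  have simple: "simple_point W z" if "Im z \<noteq> 0" for z
  proof (cases "Im z > 0")
    case True
    then obtain w where w: "w \<noteq> 0" "(Wu has_field_derivative w) (at z)"
      using Wu_deriv by blast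
    have "(W has_field_derivative w) (at z)"
      by (rule has_field_derivative_transform_within_open[OF w(2) open_halfspace_Im_gt[of 0]])
        (use True W_up in auto)
    then show ?thesis
      using w(1) by (auto simp: simple_point_def dest: DERIV_imp_deriv)
  next
    case False
    then have neg: "Im (cnj z) > 0"
      using that by simp
    obtain w where w: "w \<noteq> 0" "(Wu has_field_derivative w) (at (cnj z))"
      using Wu_deriv[OF neg] by blast
    have "(cnj \<circ> Wu \<circ> cnj has_field_derivative cnj w) (at z)"
      using has_field_derivative_cnj_cnj[of Wu w z] w(2) by simp
    then have "(W has_field_derivative cnj w) (at z)"
      by (rule has_field_derivative_transform_within_open[OF _ open_halfspace_Im_lt[of 0]])
        (use neg W_down in auto)
    then show ?thesis
      using w(1) by (auto simp: simple_point_def dest: DERIV_imp_deriv)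
  qed
  have down: "Wu (cnj z) = cnj \<alpha>" if "Im z < 0" "W z = \<alpha>" for z
    using W_down[OF that(1)] that(2) by (metis complex_cnj_cnj)
  have distinct: "cmod w \<noteq> cmod z" if "W z = \<alpha>" "W w = \<alpha>" "w \<noteq> z" for z w
  proof
    assume eq: "cmod w = cmod z"
    \<comment> \<open>The mirror image of w lies in the upper half-plane and has the value
      \<open>cnj \<alpha>\<close>; it would coincide with z, giving \<alpha> =
      \<open>cnj \<alpha>\<close>.\<close>
    have mixed: False if "Im z > 0" "Im w < 0" "W z = \<alpha>" "W w = \<alpha>" "cmod w = cmod z" for z w
    proof -
      have "z = cnj w"
        using Wu_distinct[of z "cnj w"] down[of w] W_up[of z] that by simp
      then show False
        using down[of w] W_up[of z] that \<alpha>(3) by simp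
    qed
    have "Im z \<noteq> 0" "Im w \<noteq> 0"
      using nonreal that by auto
    then consider "Im z > 0" "Im w > 0" | "Im z < 0" "Im w < 0"
      | "Im z > 0" "Im w < 0" | "Im z < 0" "Im w > 0"
      by linarith
    then show False
    proof cases
      case 1
      then show False
        using Wu_distinct[of z w] W_up eq that by simp
    next
      case 2
      then show False
        using Wu_distinct[of "cnj z" "cnj w"] down eq that by simp
    next
      case 3
      then show False
        using mixed[of z w] eq that by simp
    next
      case 4
      then show False
        using mixed[of w z] eq that by simp
    qed
  qed
  have alternate: "Im z * Im w < 0" if "consecutive_in (alpha_set W \<alpha>) z w" for z w
  proof -
    have zw: "W z = \<alpha>" "W w = \<alpha>" "z \<noteq> w" "cmod z \<le> cmod w"
      and none: "\<And>u. W u = \<alpha> \<Longrightarrow> cmod z < cmod u \<Longrightarrow> cmod u < cmod w \<Longrightarrow> False"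
      using that by (auto simp: consecutive_in_def alpha_set_def)
    have lt: "cmod z < cmod w"
      using zw distinct[of w z] by force
    have "\<not> (Im z > 0 \<and> Im w > 0)"
    proof
      assume im: "Im z > 0 \<and> Im w > 0"
      \<comment> \<open>The conjugate of u is an \<alpha>-point of the lower half-plane strictly
        between z and w.\<close>
      then obtain u where "Im u > 0" "cmod z < cmod u" "cmod u < cmod w" "Wu u = cnj \<alpha>"
        using Wu_between[of z w \<alpha>] lt W_up zw \<alpha> by auto
      then show False
        using none[of "cnj u"] W_down[of "cnj u"] by simp
    qed
    moreover have "\<not> (Im z < 0 \<and> Im w < 0)"
    proof
      assume im: "Im z < 0 \<and> Im w < 0"
      \<comment> \<open>After reflection both values are \<open>cnj \<alpha>\<close>, so the point
        in between has the value \<alpha> itself.\<close>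
      then obtain u where "Im u > 0" "cmod z < cmod u" "cmod u < cmod w" "Wu u = \<alpha>"
        using Wu_between[of "cnj z" "cnj w" "cnj \<alpha>"] lt down zw cnj_\<alpha> by auto
      then show False
        using none[of u] W_up[of u] by simp
    qed
    ultimately show ?thesis
      using nonreal[OF zw(1)] nonreal[OF zw(2)] by (auto simp: mult_less_0_iff)
  qed
  have "W_plus W (- x) \<noteq> \<alpha>" "W_minus W (- x) \<noteq> \<alpha>" if "x > 0" for x
  proof -
    note lim = Wu_limit_negative[OF that]
    have "((\<lambda>y. W (Complex (- x) y)) \<longlongrightarrow> Wu (of_real (- x))) (at_right 0)"
      by (rule Lim_transform_eventually[OF lim]) (auto intro!: eventually_at_rightI[of 0 1] simp: W_up)
    then have "W_plus W (- x) = Wu (of_real (- x))"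
      unfolding W_plus_def by (intro tendsto_Lim) auto
    then show "W_plus W (- x) \<noteq> \<alpha>"
      using neg_axis[OF that] by simp
    \<comment> \<open>The limit from below is the conjugate of the limit from above, by the
      substitution of -y for y.\<close>
    have "((\<lambda>y. cnj (Wu (Complex (- x) (- y)))) \<longlongrightarrow> cnj (Wu (of_real (- x)))) (at_left 0)"
      using tendsto_cnj[OF lim] by (subst filterlim_at_left_to_right) simp
    then have "((\<lambda>y. W (Complex (- x) y)) \<longlongrightarrow> cnj (Wu (of_real (- x)))) (at_left 0)"
      by (rule Lim_transform_eventually) (auto intro!: eventually_at_leftI[of "-1" 0] simp: W_down complex_cnj)
    then have "W_minus W (- x) = cnj (Wu (of_real (- x)))"
      unfolding W_minus_def by (intro tendsto_Lim) auto
    then show "W_minus W (- x) \<noteq> \<alpha>"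
      using neg_axis(2)[OF that] by (metis complex_cnj_cnj)
  qed
  then show ?thesis
    using simple distinct alternate pos_axis by (auto simp: alpha_set_def)
qed

end
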